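(* Let $(M,F)$ be a complex Finsler space of complex dimension $2$. If $(M,F)$ is Kähler, then $\dot\partial_{\bar h}G^i=0$ for all $i,h\in\{1,2\}$, i.e. the spray coefficients $G^i$ are holomorphic in $\eta$.
   Context: $M$ is a complex manifold with $\dim_{\mathbb C}M=2$; $T'M$ is its holomorphic tangent bundle with local coordinates $(z^k,\eta^k)_{k=1,2}$; $\widetilde{T'M}$ is $T'M$ minus the zero section. A complex Finsler space $(M,F)$: $F:T'M\to[0,\infty)$ is continuous, $L:=F^2$ is smooth on $\widetilde{T'M}$, $F(z,\eta)=0$ iff $\eta=0$, $F(z,\lambda\eta)=|\lambda|F(z,\eta)$ for all $\lambda\in\mathbb C$, and the Hermitian matrix $g_{i\bar j}:=\partial^2L/\partial\eta^i\partial\bar\eta^j$ is positive definite on $\widetilde{T'M}$. Repeated indices are summed over $\{1,2\}$; everything lives on $\widetilde{T'M}$. $(g^{\bar m i})$ is the inverse matrix: $g^{\bar m i}g_{j\bar m}=\delta^i_j$. Chern–Finsler connection: $\dot\partial_k:=\partial/\partial\eta^k$, $\dot\partial_{\bar k}:=\partial/\partial\bar\eta^k$, $N^k_j:=g^{\bar mk}\frac{\partial g_{l\bar m}}{\partial z^j}\eta^l$, $\delta_k:=\frac{\partial}{\partial z^k}-N^j_k\dot\partial_j$, $L^i_{jk}:=g^{\bar li}\delta_kg_{j\bar l}$. The spray coefficients are $G^i:=\frac12N^i_j\eta^j$. With $T^i_{jk}:=L^i_{jk}-L^i_{kj}$, the space is Kähler if $T^i_{jk}\eta^j=0$ (this is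 known to be equivalent to $T^i_{jk}=0$). *)

theory Defs
  imports "HOL-Analysis.Analysis"
begin

primrec Ck_on :: "nat \<Rightarrow> 'a::real_normed_vector set \<Rightarrow> ('a \<Rightarrow> 'b::real_normed_vector) \<Rightarrow> bool" where
  "Ck_on 0 S f \<longleftrightarrow> continuous_on S f"
| "Ck_on (Suc k) S f \<longleftrightarrow>
     (\<forall>x\<in>S. f differentiable (at x)) \<and> (\<forall>v. Ck_on k S (\<lambda>x. frechet_derivative f (at x) v))"

text \<open>Intended for open subsets of finite-dimensional spaces, where continuity of every directional
  derivative amounts to continuity of the total derivative.\<close>

definition smooth_on :: "'a::real_normed_vector set \<Rightarrow> ('a \<Rightarrow> 'b::real_normed_vector) \<Rightarrow> bool" where
  "smooth_on S f \<longleftrightarrow> (\<forall>k. Ck_on k S f)"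

definition holomorphic_map_on :: "(complex^'n) set \<Rightarrow> (complex^'n \<Rightarrow> complex^'m) \<Rightarrow> bool" where
  "holomorphic_map_on S f \<longleftrightarrow>
     (\<forall>x\<in>S. \<exists>f'. (f has_derivative f') (at x) \<and> (\<forall>c v. f' (c *s v) = c *s f' v))"

type_synonym ('a, 'n) chart = "'a set \<times> ('a \<Rightarrow> complex^'n)"

definition chart_inv :: "('a, 'n::finite) chart \<Rightarrow> complex^'n \<Rightarrow> 'a" where
  "chart_inv c = inv_into (fst c) (snd c)"

definition chart_image :: "('a, 'n::finite) chart \<Rightarrow> (complex^'n) set" where
  "chart_image c = snd c ` fst c"

definition is_chart :: "'a topology \<Rightarrow> ('a, 'n::finite) chart \<Rightarrow> bool" where
  "is_chart X c \<longleftrightarrow> openin X (fst c) \<and> open (chart_image c) \<and>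
     homeomorphic_map (subtopology X (fst c)) (top_of_set (chart_image c)) (snd c)"

definition transition :: "('a, 'n::finite) chart \<Rightarrow> ('a, 'n) chart \<Rightarrow> complex^'n \<Rightarrow> complex^'n" where
  "transition c d = snd d \<circ> chart_inv c"

definition complex_manifold :: "'a topology \<Rightarrow> ('a, 'n::finite) chart set \<Rightarrow> bool" where
  "complex_manifold X A \<longleftrightarrow>
     Hausdorff_space X \<and> second_countable X \<and>
     (\<forall>c\<in>A. is_chart X c) \<and>
     topspace X = (\<Union>c\<in>A. fst c) \<and>
     (\<forall>c\<in>A. \<forall>d\<in>A. holomorphic_map_on (snd c ` (fst c \<inter> fst d)) (transition c d))"

text \<open>A holomorphic tangent vector at a point \<open>p\<close> is represented by \<open>p\<close> together with its
  component vector in every chart around \<open>p\<close>; the components in two charts are related by the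
  complex Jacobian of the transition map. Components at charts not containing \<open>p\<close> are set to
  \<open>0\<close>, so that distinct representatives are distinct vectors.\<close>

type_synonym ('a, 'n) tvec = "'a \<times> (('a, 'n) chart \<Rightarrow> complex^'n)"

definition tangent_bundle :: "('a, 'n::finite) chart set \<Rightarrow> ('a, 'n) tvec set" where
  "tangent_bundle A = {(p, v).
     p \<in> (\<Union>c\<in>A. fst c) \<and>
     (\<forall>c\<in>A. \<forall>d\<in>A. p \<in> fst c \<inter> fst d \<longrightarrow>
        v d = frechet_derivative (transition c d) (at (snd c p)) (v c)) \<and>
     (\<forall>c. \<not> (c \<in> A \<and> p \<in> fst c) \<longrightarrow> v c = 0)}"

definition tscale :: "complex \<Rightarrow> ('a, 'n::finite) tvec \<Rightarrow> ('a, 'n) tvec" where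
  "tscale a x = (fst x, \<lambda>c. a *s snd x c)"

text \<open>The tangent vector with coordinates \<open>(z, \<eta>)\<close> in the bundle chart induced by \<open>c\<close>,
  that is, \<open>\<eta>\<^sup>k \<partial>/\<partial>z\<^sup>k\<close> at the point with coordinates \<open>z\<close>.\<close>

definition tvec_of ::
  "('a, 'n::finite) chart set \<Rightarrow> ('a, 'n) chart \<Rightarrow> (complex^'n) \<times> (complex^'n) \<Rightarrow> ('a, 'n) tvec" where
  "tvec_of A c = (\<lambda>(z, \<eta>).
     (chart_inv c z,
      \<lambda>d. if d \<in> A \<and> chart_inv c z \<in> fst d
          then frechet_derivative (transition c d) (at z) \<eta> else 0))"

definition slit :: "('a, 'n::finite) chart \<Rightarrow> ((complex^'n) \<times> (complex^'n)) set" where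
  "slit c = chart_image c \<times> (- {0})"

definition d_z :: "'n \<Rightarrow> ((complex^'n) \<times> (complex^'n::finite) \<Rightarrow> complex) \<Rightarrow> (complex^'n) \<times> (complex^'n) \<Rightarrow> complex" where
  "d_z k f x = (frechet_derivative f (at x) (axis k 1, 0)
                - \<i> * frechet_derivative f (at x) (axis k \<i>, 0)) / 2"

definition d_eta :: "'n \<Rightarrow> ((complex^'n) \<times> (complex^'n::finite) \<Rightarrow> complex) \<Rightarrow> (complex^'n) \<times> (complex^'n) \<Rightarrow> complex" where
  "d_eta k f x = (frechet_derivative f (at x) (0, axis k 1)
                  - \<i> * frechet_derivative f (at x) (0, axis k \<i>)) / 2"

definition d_etabar :: "'n \<Rightarrow> ((complex^'n) \<times> (complex^'n::finite) \<Rightarrow> complex) \<Rightarrow> (complex^'n) \<times> (complex^'n) \<Rightarrow> complex" where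
  "d_etabar k f x = (frechet_derivative f (at x) (0, axis k 1)
                     + \<i> * frechet_derivative f (at x) (0, axis k \<i>)) / 2"

text \<open>Throughout, \<open>L\<close> is the coordinate expression of \<open>F\<^sup>2\<close>, viewed as complex valued, in
  a bundle chart. In \<open>metric L x\<close> the entry \<open>$ i $ j\<close> is \<open>g\<^bsub>i j-bar\<^esub>\<close>; correspondingly
  \<open>$ m $ i\<close> of its inverse is \<open>g\<^bsup>m-bar i\<^esup>\<close>.\<close>

definition metric :: "((complex^'n) \<times> (complex^'n::finite) \<Rightarrow> complex) \<Rightarrow> (complex^'n) \<times> (complex^'n) \<Rightarrow> complex^'n^'n" where
  "metric L x = (\<chi> i j. d_eta i (d_etabar j L) x)"

definition metric_inv :: "((complex^'n) \<times> (complex^'n::finite) \<Rightarrow> complex) \<Rightarrow> (complex^'n) \<times> (complex^'n) \<Rightarrow> complex^'n^'n" where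
  "metric_inv L x = matrix_inv (metric L x)"

definition hermitian_pos_def :: "complex^'n^'n::finite \<Rightarrow> bool" where
  "hermitian_pos_def H \<longleftrightarrow>
     (\<forall>i j. H $ j $ i = cnj (H $ i $ j)) \<and>
     (\<forall>v. v \<noteq> 0 \<longrightarrow> Re (\<Sum>i\<in>UNIV. \<Sum>j\<in>UNIV. H $ i $ j * v $ i * cnj (v $ j)) > 0)"

text \<open>\<open>cf_N L k j\<close> is \<open>N\<^sup>k\<^sub>j\<close>.\<close>

definition cf_N :: "((complex^'n) \<times> (complex^'n::finite) \<Rightarrow> complex) \<Rightarrow> 'n \<Rightarrow> 'n \<Rightarrow> (complex^'n) \<times> (complex^'n) \<Rightarrow> complex" where
  "cf_N L k j x = (\<Sum>m\<in>UNIV. \<Sum>l\<in>UNIV.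
     metric_inv L x $ m $ k * d_z j (\<lambda>y. metric L y $ l $ m) x * snd x $ l)"

definition cf_delta :: "((complex^'n) \<times> (complex^'n::finite) \<Rightarrow> complex) \<Rightarrow> 'n \<Rightarrow>
    ((complex^'n) \<times> (complex^'n) \<Rightarrow> complex) \<Rightarrow> (complex^'n) \<times> (complex^'n) \<Rightarrow> complex" where
  "cf_delta L k f x = d_z k f x - (\<Sum>j\<in>UNIV. cf_N L j k x * d_eta j f x)"

text \<open>\<open>cf_L L i j k\<close> is \<open>L\<^sup>i\<^sub>j\<^sub>k\<close>, and likewise for the torsion.\<close>

definition cf_L :: "((complex^'n) \<times> (complex^'n::finite) \<Rightarrow> complex) \<Rightarrow> 'n \<Rightarrow> 'n \<Rightarrow> 'n \<Rightarrow> (complex^'n) \<times> (complex^'n) \<Rightarrow> complex" where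
  "cf_L L i j k x = (\<Sum>l\<in>UNIV. metric_inv L x $ l $ i * cf_delta L k (\<lambda>y. metric L y $ j $ l) x)"

definition cf_torsion :: "((complex^'n) \<times> (complex^'n::finite) \<Rightarrow> complex) \<Rightarrow> 'n \<Rightarrow> 'n \<Rightarrow> 'n \<Rightarrow> (complex^'n) \<times> (complex^'n) \<Rightarrow> complex" where
  "cf_torsion L i j k x = cf_L L i j k x - cf_L L i k j x"

definition spray :: "((complex^'n) \<times> (complex^'n::finite) \<Rightarrow> complex) \<Rightarrow> 'n \<Rightarrow> (complex^'n) \<times> (complex^'n) \<Rightarrow> complex" where
  "spray L i x = (\<Sum>j\<in>UNIV. cf_N L i j x * snd x $ j) / 2"

definition local_L ::
  "('a, 'n::finite) chart set \<Rightarrow> (('a, 'n) tvec \<Rightarrow> real) \<Rightarrow> ('a, 'n) chart \<Rightarrow> (complex^'n) \<times> (complex^'n) \<Rightarrow> complex" where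
  "local_L A F c x = complex_of_real ((F (tvec_of A c x))\<^sup>2)"

text \<open>Continuity of \<open>F\<close> and smoothness of \<open>F\<^sup>2\<close> refer to the topology and smooth structure of
  the tangent bundle, and are therefore stated in the bundle charts.\<close>

definition complex_finsler ::
  "'a topology \<Rightarrow> ('a, 'n::finite) chart set \<Rightarrow> (('a, 'n) tvec \<Rightarrow> real) \<Rightarrow> bool" where
  "complex_finsler X A F \<longleftrightarrow>
     complex_manifold X A \<and>
     (\<forall>x\<in>tangent_bundle A. F x \<ge> 0) \<and>
     (\<forall>c\<in>A. continuous_on (chart_image c \<times> UNIV) (\<lambda>x. F (tvec_of A c x))) \<and>
     (\<forall>c\<in>A. smooth_on (slit c) (\<lambda>x. (F (tvec_of A c x))\<^sup>2)) \<and>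
     (\<forall>x\<in>tangent_bundle A. F x = 0 \<longleftrightarrow> snd x = (\<lambda>c. 0)) \<and>
     (\<forall>x\<in>tangent_bundle A. \<forall>a. F (tscale a x) = cmod a * F x) \<and>
     (\<forall>c\<in>A. \<forall>x\<in>slit c. hermitian_pos_def (metric (local_L A F c) x))"

definition kaehler_finsler :: "('a, 'n::finite) chart set \<Rightarrow> (('a, 'n) tvec \<Rightarrow> real) \<Rightarrow> bool" where
  "kaehler_finsler A F \<longleftrightarrow>
     (\<forall>c\<in>A. \<forall>x\<in>slit c. \<forall>i k.
        (\<Sum>j\<in>UNIV. cf_torsion (local_L A F c) i j k x * snd x $ j) = 0)"

end

theory Submission
  imports Defs
begin

text \<open>
  Write \<open>A\<close> for the lowered derivative \<open>g\<^sub>k\<^sub>n \<partial>G\<^sup>k/\<partial>\<eta>-bar\<^sup>h\<close> of the spray coefficients. Differentiating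
  the defining equation of \<open>G\<close> shows that \<open>A\<close> is symmetric in \<open>n, h\<close> and, by homogeneity of
  \<open>L\<close>, annihilated by \<open>\<eta>-bar\<close>. The Kaehler condition expresses \<open>\<partial>\<^sup>2L/\<partial>z\<^sup>k\<partial>\<eta>-bar\<^sup>n\<close> through
  \<open>G\<close>; its \<open>\<eta>-bar\<^sup>h\<close>-derivative is symmetric in \<open>n, h\<close>, and contracting with \<open>\<eta>-bar\<close> leaves
  \<open>\<partial>G\<^sup>i/\<partial>\<eta>-bar\<^sup>h L\<^sub>i\<^sub>k = 0\<close> for the Hessian \<open>L\<^sub>i\<^sub>k = \<partial>\<^sup>2L/\<partial>\<eta>\<^sup>i\<partial>\<eta>\<^sup>k\<close>, whose kernel also contains \<open>\<eta>\<close>.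
  In dimension two a nonzero Hessian forces \<open>\<partial>G/\<partial>\<eta>-bar\<^sup>h\<close> to be a multiple of \<open>\<eta>\<close>, and the
  multiple is zero because \<open>A\<close> annihilates \<open>\<eta>-bar\<close> while \<open>g(\<eta>, \<eta>) = L \<noteq> 0\<close>. On the open set
  where \<open>A \<noteq> 0\<close> the Hessian therefore vanishes identically, which makes \<open>A\<close> vanish there too.
\<close>

section \<open>Smooth functions and symmetry of second derivatives\<close>

lemma frechet_derivative_eqI:
  "(f has_derivative f') (at x) \<Longrightarrow> frechet_derivative f (at x) = f'"
  using frechet_derivative_at by metis

lemma has_frechet_derivative:
  "f differentiable (at x) \<Longrightarrow> (f has_derivative frechet_derivative f (at x)) (at x)"
  by (simp add: frechet_derivative_works)

lemma differentiable_transform_open: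
  assumes "f differentiable (at x)" "open S" "x \<in> S" "\<And>y. y \<in> S \<Longrightarrow> f y = g y"
  shows "g differentiable (at x)"
  using has_derivative_transform_within_open[OF has_frechet_derivative[OF assms(1)] assms(2-4)]
  by (rule differentiableI)

text \<open>\<open>Ck_on\<close> takes derivatives with \<open>at x\<close>, which see a full
  neighbourhood; openness of \<open>S\<close> makes agreement on \<open>S\<close> alone
  enough.\<close>

lemma Ck_on_cong:
  assumes "open S" "Ck_on k S f" "\<And>x. x \<in> S \<Longrightarrow> f x = g x"
  shows "Ck_on k S g"
  using assms(2,3)
proof (induction k arbitrary: f g)
  case 0
  then show ?case using continuous_on_cong by (metis Ck_on.simps(1))
next
  case (Suc k)
  have diff: "f differentiable (at x)" if "x \<in> S" for x using Suc.prems that by simp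
  have eq: "frechet_derivative f (at x) = frechet_derivative g (at x)" if "x \<in> S" for x
    using frechet_derivative_transform_within_open[OF diff[OF that] assms(1) that] Suc.prems(2) by simp
  have "g differentiable (at x)" if "x \<in> S" for x
    by (rule differentiable_transform_open[OF diff[OF that] assms(1) that Suc.prems(2)])
  moreover have "Ck_on k S (\<lambda>x. frechet_derivative g (at x) v)" for v
    using Suc.IH[of "\<lambda>x. frechet_derivative f (at x) v"] Suc.prems(1) eq by simp
  ultimately show ?case by simp
qed

lemma Ck_on_linear_image:
  assumes "open S" "bounded_linear T" "Ck_on k S f"
  shows "Ck_on k S (\<lambda>x. T (f x))"
  using assms(3)
proof (induction k arbitrary: f)
  case 0
  then show ?case using bounded_linear.continuous_on[OF assms(2)] by simp
next
  case (Suc k)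
  have D: "((\<lambda>y. T (f y)) has_derivative (\<lambda>v. T (frechet_derivative f (at x) v))) (at x)"
    if "x \<in> S" for x
    by (rule bounded_linear.has_derivative[OF assms(2) has_frechet_derivative])
      (use Suc.prems that in simp)
  have "Ck_on k S (\<lambda>x. frechet_derivative (\<lambda>y. T (f y)) (at x) v)" for v
    by (rule Ck_on_cong[OF assms(1), of _ "\<lambda>x. T (frechet_derivative f (at x) v)"])
      (use Suc.IH[of "\<lambda>x. frechet_derivative f (at x) v"] Suc.prems in
        \<open>simp_all add: frechet_derivative_eqI[OF D]\<close>)
  then show ?case using D by (auto intro: differentiableI)
qed

lemma Ck_on_add:
  assumes "open S" "Ck_on k S f" "Ck_on k S g"
  shows "Ck_on k S (\<lambda>x. f x + g x)"
  using assms(2,3)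
proof (induction k arbitrary: f g)
  case 0
  then show ?case by (simp add: continuous_on_add)
next
  case (Suc k)
  have D: "((\<lambda>y. f y + g y) has_derivative
      (\<lambda>v. frechet_derivative f (at x) v + frechet_derivative g (at x) v)) (at x)" if "x \<in> S" for x
    by (intro has_derivative_add has_frechet_derivative) (use Suc.prems that in simp_all)
  have "Ck_on k S (\<lambda>x. frechet_derivative (\<lambda>y. f y + g y) (at x) v)" for v
    by (rule Ck_on_cong[OF assms(1),
          of _ "\<lambda>x. frechet_derivative f (at x) v + frechet_derivative g (at x) v"])
      (use Suc.IH[of "\<lambda>x. frechet_derivative f (at x) v" "\<lambda>x. frechet_derivative g (at x) v"]
        Suc.prems in \<open>simp_all add: frechet_derivative_eqI[OF D]\<close>)
  then show ?case using D by (auto intro: differentiableI)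
qed

lemma smooth_on_linear_image:
  "open S \<Longrightarrow> bounded_linear T \<Longrightarrow> smooth_on S f \<Longrightarrow> smooth_on S (\<lambda>x. T (f x))"
  unfolding smooth_on_def using Ck_on_linear_image by blast

lemma smooth_on_add:
  "open S \<Longrightarrow> smooth_on S f \<Longrightarrow> smooth_on S g \<Longrightarrow> smooth_on S (\<lambda>x. f x + g x)"
  unfolding smooth_on_def using Ck_on_add by blast

lemma smooth_on_differentiable: "smooth_on S f \<Longrightarrow> x \<in> S \<Longrightarrow> f differentiable (at x)"
  unfolding smooth_on_def by (metis Ck_on.simps(2))

lemma smooth_on_derivative: "smooth_on S f \<Longrightarrow> smooth_on S (\<lambda>x. frechet_derivative f (at x) v)"
  unfolding smooth_on_def by (metis Ck_on.simps(2))

lemma smooth_on_continuous: "smooth_on S f \<Longrightarrow> continuous_on S f"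
  unfolding smooth_on_def by (metis Ck_on.simps(1))

text \<open>The mean value theorem is applied twice: along \<open>v\<close> to the difference of two
  translates of \<open>f\<close>, then along \<open>w\<close> to the derivative of \<open>f\<close>
  in direction \<open>v\<close>.\<close>

lemma second_difference_mvt:
  fixes f :: "'a::real_normed_vector \<Rightarrow> real"
  assumes "t > 0"
    and seg: "\<And>s r. 0 \<le> s \<Longrightarrow> s \<le> t \<Longrightarrow> 0 \<le> r \<Longrightarrow> r \<le> t \<Longrightarrow> x + s *\<^sub>R v + r *\<^sub>R w \<in> S"
    and sm: "smooth_on S f"
  obtains s r where "0 < s" "s < t" "0 < r" "r < t"
    "f (x + t *\<^sub>R v + t *\<^sub>R w) - f (x + t *\<^sub>R v) - f (x + t *\<^sub>R w) + f x =
     t\<^sup>2 * frechet_derivative (\<lambda>y. frechet_derivative f (at y) v) (at (x + s *\<^sub>R v + r *\<^sub>R w)) w"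
proof -
  have line: "((\<lambda>s. h (a + s *\<^sub>R u)) has_derivative
      (\<lambda>d. d * frechet_derivative h (at (a + s *\<^sub>R u)) u)) (at s)"
    if "h differentiable (at (a + s *\<^sub>R u))" for h :: "'a \<Rightarrow> real" and a u s
  proof -
    have 1: "((\<lambda>s. a + s *\<^sub>R u) has_derivative (\<lambda>d. d *\<^sub>R u)) (at s)"
      by (auto intro!: derivative_eq_intros)
    have "((\<lambda>s. h (a + s *\<^sub>R u)) has_derivative
        (\<lambda>d. frechet_derivative h (at (a + s *\<^sub>R u)) (d *\<^sub>R u))) (at s)"
      using has_derivative_compose[OF 1, of h] that frechet_derivative_works by blast
    then show ?thesis
      using linear_frechet_derivative[OF that] by (simp add: linear_cmul)
  qed
  define Dv where "Dv = (\<lambda>y. frechet_derivative f (at y) v)"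
  have smDv: "smooth_on S Dv" unfolding Dv_def by (rule smooth_on_derivative[OF sm])
  define D2 where "D2 = (\<lambda>y. frechet_derivative Dv (at y) w)"
  define g where "g = (\<lambda>s. f (x + t *\<^sub>R w + s *\<^sub>R v) - f (x + s *\<^sub>R v))"
  have Sm: "x + t *\<^sub>R w + s *\<^sub>R v \<in> S" "x + s *\<^sub>R v \<in> S" if "0 \<le> s" "s \<le> t" for s
    using seg[OF that, of t] seg[OF that, of 0] assms(1) by (simp_all add: algebra_simps)
  have g: "(g has_derivative (\<lambda>d. d * (Dv (x + t *\<^sub>R w + s *\<^sub>R v) - Dv (x + s *\<^sub>R v)))) (at s)"
    if "0 \<le> s" "s \<le> t" for s
    unfolding g_def Dv_def right_diff_distrib
    by (intro has_derivative_diff line smooth_on_differentiable[OF sm] Sm that)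
  obtain s where s: "0 < s" "s < t"
    "g t - g 0 = (t - 0) * (Dv (x + t *\<^sub>R w + s *\<^sub>R v) - Dv (x + s *\<^sub>R v))"
    using mvt_simple[OF assms(1), of g, OF has_derivative_at_withinI[OF g]] by auto
  have h: "((\<lambda>r. Dv (x + s *\<^sub>R v + r *\<^sub>R w)) has_derivative (\<lambda>d. d * D2 (x + s *\<^sub>R v + r *\<^sub>R w))) (at r)"
    if "0 \<le> r" "r \<le> t" for r
    unfolding D2_def using s that
    by (intro line smooth_on_differentiable[OF smDv] seg) auto
  obtain r where r: "0 < r" "r < t"
    "Dv (x + s *\<^sub>R v + t *\<^sub>R w) - Dv (x + s *\<^sub>R v + 0 *\<^sub>R w) = (t - 0) * D2 (x + s *\<^sub>R v + r *\<^sub>R w)"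
    using mvt_simple[OF assms(1), OF has_derivative_at_withinI[OF h]] by auto
  have "g t - g 0 = t * (t * D2 (x + s *\<^sub>R v + r *\<^sub>R w))"
    using s(3) r(3) by (simp add: algebra_simps)
  then show thesis
    using that[OF s(1,2) r(1,2)]
    by (simp add: g_def D2_def Dv_def power2_eq_square algebra_simps)
qed

text \<open>Schwarz's theorem: the second difference is unchanged when \<open>v\<close> and
  \<open>w\<close> are exchanged, so near \<open>x\<close> some value of one mixed derivative equals
  some value of the other; continuity finishes.\<close>

lemma mixed_derivatives_commute_real:
  fixes f :: "'a::real_normed_vector \<Rightarrow> real"
  assumes "open S" "x \<in> S" and sm: "smooth_on S f"
  shows "frechet_derivative (\<lambda>y. frechet_derivative f (at y) v) (at x) w =
         frechet_derivative (\<lambda>y. frechet_derivative f (at y) w) (at x) v" (is "?A x = ?B x")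
proof (rule ccontr)
  assume ne: "?A x \<noteq> ?B x"
  \<comment> \<open>Half the gap: values within \<open>e\<close> of \<open>?A x\<close> and of
    \<open>?B x\<close> respectively cannot coincide.\<close>
  define e where "e = dist (?A x) (?B x) / 2"
  have e: "e > 0" using ne by (simp add: e_def)
  have "isCont ?A x" "isCont ?B x"
    using assms smooth_on_continuous[OF smooth_on_derivative[OF smooth_on_derivative[OF sm]]]
      continuous_on_eq_continuous_at by blast+
  then obtain d1 d2 where d: "d1 > 0" "d2 > 0"
    "\<And>y. dist y x < d1 \<Longrightarrow> dist (?A y) (?A x) < e"
    "\<And>y. dist y x < d2 \<Longrightarrow> dist (?B y) (?B x) < e"
    using e unfolding continuous_at_eps_delta by metis
  obtain d3 where d3: "d3 > 0" "ball x d3 \<subseteq> S" using assms(1,2) openE by blast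
  \<comment> \<open>Keeps the parallelogram with sides \<open>t *\<^sub>R v\<close> and
    \<open>t *\<^sub>R w\<close> inside all three balls around \<open>x\<close>; the summand 1 keeps
    the denominator positive even for zero directions.\<close>
  define t where "t = min d1 (min d2 d3) / (2 * (norm v + norm w + 1))"
  have pos: "norm v + norm w + 1 > 0" by (smt (verit) norm_ge_zero)
  have t: "t > 0" using d d3 pos by (simp add: t_def)
  have bd: "dist (x + s *\<^sub>R a + r *\<^sub>R b) x < min d1 (min d2 d3)"
    if "0 \<le> s" "s \<le> t" "0 \<le> r" "r \<le> t" "{a, b} = {v, w}" for s r a b
  proof -
    have ab: "norm a + norm b \<le> norm v + norm w + 1"
      using that(5) by (auto simp: doubleton_eq_iff)
    have "dist (x + s *\<^sub>R a + r *\<^sub>R b) x \<le> s * norm a + r * norm b"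
      using that norm_triangle_ineq[of "s *\<^sub>R a" "r *\<^sub>R b"] by (simp add: dist_norm add.assoc)
    also have "\<dots> \<le> t * norm a + t * norm b"
      using that by (intro add_mono mult_right_mono) auto
    also have "\<dots> \<le> t * (norm v + norm w + 1)"
      using ab t by (simp flip: distrib_left)
    also have "\<dots> = min d1 (min d2 d3) / 2"
      using pos by (simp add: t_def field_simps)
    also have "\<dots> < min d1 (min d2 d3)" using d d3 by auto
    finally show ?thesis .
  qed
  have seg: "x + s *\<^sub>R a + r *\<^sub>R b \<in> S"
    if "0 \<le> s" "s \<le> t" "0 \<le> r" "r \<le> t" "{a, b} = {v, w}" for s r a b
    using bd[OF that] d3(2) by (auto simp: dist_commute subset_iff)
  obtain s r where 1: "0 < s" "s < t" "0 < r" "r < t"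
    "f (x + t *\<^sub>R v + t *\<^sub>R w) - f (x + t *\<^sub>R v) - f (x + t *\<^sub>R w) + f x = t\<^sup>2 * ?A (x + s *\<^sub>R v + r *\<^sub>R w)"
    using second_difference_mvt[OF t seg sm, of v w] by auto
  obtain s' r' where 2: "0 < s'" "s' < t" "0 < r'" "r' < t"
    "f (x + t *\<^sub>R w + t *\<^sub>R v) - f (x + t *\<^sub>R w) - f (x + t *\<^sub>R v) + f x = t\<^sup>2 * ?B (x + s' *\<^sub>R w + r' *\<^sub>R v)"
    using second_difference_mvt[OF t seg sm, of w v] by auto
  have "t\<^sup>2 * ?A (x + s *\<^sub>R v + r *\<^sub>R w) = t\<^sup>2 * ?B (x + s' *\<^sub>R w + r' *\<^sub>R v)"
    using 1(5) 2(5) by (simp add: algebra_simps)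
  then have "?A (x + s *\<^sub>R v + r *\<^sub>R w) = ?B (x + s' *\<^sub>R w + r' *\<^sub>R v)"
    using t by simp
  moreover have "dist (?A (x + s *\<^sub>R v + r *\<^sub>R w)) (?A x) < e"
    using bd[of s r v w] 1 by (intro d(3)) auto
  moreover have "dist (?B (x + s' *\<^sub>R w + r' *\<^sub>R v)) (?B x) < e"
    using bd[of s' r' w v] 2 by (intro d(4)) auto
  moreover have "dist (?A x) (?B x) = 2 * e" by (simp add: e_def)
  ultimately show False by (simp add: dist_real_def abs_less_iff abs_if split: if_splits)
qed

lemma frechet_derivative_linear_image:
  "bounded_linear T \<Longrightarrow> f differentiable (at x) \<Longrightarrow>
   frechet_derivative (\<lambda>y. T (f y)) (at x) = (\<lambda>v. T (frechet_derivative f (at x) v))"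
  by (subst frechet_derivative_eqI[OF bounded_linear.has_derivative[OF _ has_frechet_derivative]]) simp_all

text \<open>Pairing with an arbitrary vector \<open>u\<close> reduces the claim to real-valued
  functions.\<close>

lemma mixed_derivatives_commute:
  fixes f :: "'a::real_normed_vector \<Rightarrow> 'b::real_inner"
  assumes "open S" "x \<in> S" and sm: "smooth_on S f"
  shows "frechet_derivative (\<lambda>y. frechet_derivative f (at y) v) (at x) w =
         frechet_derivative (\<lambda>y. frechet_derivative f (at y) w) (at x) v"
proof -
  have *: "frechet_derivative (\<lambda>y. frechet_derivative (\<lambda>y. f y \<bullet> u) (at y) v) (at x) w =
      frechet_derivative (\<lambda>y. frechet_derivative f (at y) v) (at x) w \<bullet> u" for u v w
  proof -
    have in1: "frechet_derivative (\<lambda>y. f y \<bullet> u) (at y) v = frechet_derivative f (at y) v \<bullet> u"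
      if "y \<in> S" for y
      using that sm
      by (simp add: frechet_derivative_linear_image[OF bounded_linear_inner_left smooth_on_differentiable])
    have eq: "frechet_derivative (\<lambda>y. frechet_derivative f (at y) v \<bullet> u) (at x) =
        frechet_derivative (\<lambda>y. frechet_derivative (\<lambda>y. f y \<bullet> u) (at y) v) (at x)"
      by (rule frechet_derivative_transform_within_open[OF smooth_on_differentiable assms(1,2)],
          rule smooth_on_linear_image[OF assms(1) bounded_linear_inner_left smooth_on_derivative[OF sm]])
        (simp_all add: in1 assms(2))
    show ?thesis
      by (simp add: eq[symmetric] frechet_derivative_linear_image[OF bounded_linear_inner_left
          smooth_on_differentiable[OF smooth_on_derivative[OF sm] assms(2)]])
  qed
  have "frechet_derivative (\<lambda>y. frechet_derivative f (at y) v) (at x) w \<bullet> u =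
        frechet_derivative (\<lambda>y. frechet_derivative f (at y) w) (at x) v \<bullet> u" for u
    unfolding *[symmetric]
    by (rule mixed_derivatives_commute_real[OF assms(1,2)
          smooth_on_linear_image[OF assms(1) bounded_linear_inner_left sm]])
  then show ?thesis by (meson vector_eq_rdot)
qed

section \<open>Wirtinger derivatives\<close>

text \<open>One formula for all Wirtinger operators: \<open>p\<close> and \<open>q\<close> are the
  real and imaginary directions of a coordinate, \<open>c = - \<i>\<close> gives the holomorphic
  derivative, \<open>c = \<i>\<close> the antiholomorphic one.\<close>

definition wirtinger ::
  "complex \<Rightarrow> 'a \<Rightarrow> 'a \<Rightarrow> ('a::real_normed_vector \<Rightarrow> complex) \<Rightarrow> 'a \<Rightarrow> complex" where
  "wirtinger c p q f x =
     (frechet_derivative f (at x) p + c * frechet_derivative f (at x) q) / 2"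

lemma d_z_wirtinger: "d_z k = wirtinger (- \<i>) (axis k 1, 0) (axis k \<i>, 0)"
  by (simp add: fun_eq_iff d_z_def wirtinger_def)

lemma d_eta_wirtinger: "d_eta k = wirtinger (- \<i>) (0, axis k 1) (0, axis k \<i>)"
  by (simp add: fun_eq_iff d_eta_def wirtinger_def)

lemma d_etabar_wirtinger: "d_etabar k = wirtinger \<i> (0, axis k 1) (0, axis k \<i>)"
  by (simp add: fun_eq_iff d_etabar_def wirtinger_def)

lemma wirtinger_cong:
  assumes "open S" "x \<in> S" "\<And>y. y \<in> S \<Longrightarrow> f y = g y" "f differentiable (at x)"
  shows "wirtinger c p q f x = wirtinger c p q g x"
  using frechet_derivative_transform_within_open[OF assms(4,1,2,3)] by (simp add: wirtinger_def)

lemma wirtinger_diff: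
  assumes "f differentiable (at x)" "g differentiable (at x)"
  shows "wirtinger c p q (\<lambda>y. f y - g y) x = wirtinger c p q f x - wirtinger c p q g x"
  by (simp add: wirtinger_def field_simps
      frechet_derivative_eqI[OF has_derivative_diff[OF assms[THEN has_frechet_derivative]]])

lemma wirtinger_mult:
  assumes "f differentiable (at x)" "g differentiable (at x)"
  shows "wirtinger c p q (\<lambda>y. f y * g y) x = f x * wirtinger c p q g x + wirtinger c p q f x * g x"
  by (simp add: wirtinger_def field_simps
      frechet_derivative_eqI[OF has_derivative_mult[OF assms[THEN has_frechet_derivative]]])

lemma wirtinger_sum:
  assumes "\<And>i. i \<in> I \<Longrightarrow> f i differentiable (at x)"
  shows "wirtinger c p q (\<lambda>y. \<Sum>i\<in>I. f i y) x = (\<Sum>i\<in>I. wirtinger c p q (f i) x)"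
  by (simp add: wirtinger_def sum.distrib sum_divide_distrib add_divide_distrib sum_distrib_left
      frechet_derivative_eqI[OF has_derivative_sum[OF assms[THEN has_frechet_derivative]]])

lemma wirtinger_cnj:
  assumes "f differentiable (at x)"
  shows "wirtinger c p q (\<lambda>y. cnj (f y)) x = cnj (wirtinger (cnj c) p q f x)"
  by (simp add: wirtinger_def frechet_derivative_linear_image[OF bounded_linear_cnj assms])

lemma smooth_on_wirtinger:
  assumes "open S" "smooth_on S f"
  shows "smooth_on S (wirtinger c p q f)"
proof -
  have "smooth_on S (\<lambda>x. 1/2 * frechet_derivative f (at x) p + c/2 * frechet_derivative f (at x) q)"
    by (intro smooth_on_add smooth_on_linear_image[OF _ bounded_linear_mult_right]
        smooth_on_derivative assms)
  then show ?thesis unfolding wirtinger_def by (simp add: add_divide_distrib)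
qed

lemma wirtinger_commute:
  assumes "open S" "x \<in> S" and sm: "smooth_on S f"
  shows "wirtinger c p q (wirtinger c' p' q' f) x = wirtinger c' p' q' (wirtinger c p q f) x"
proof -
  have D: "frechet_derivative (wirtinger c p q f) (at x) v =
      (frechet_derivative (\<lambda>y. frechet_derivative f (at y) p) (at x) v +
       c * frechet_derivative (\<lambda>y. frechet_derivative f (at y) q) (at x) v) / 2" for c p q v
  proof -
    note d = has_frechet_derivative[OF smooth_on_differentiable[OF smooth_on_derivative[OF sm] assms(2)]]
    have "((\<lambda>y. (frechet_derivative f (at y) p + c * frechet_derivative f (at y) q) / 2) has_derivative
      (\<lambda>v. (frechet_derivative (\<lambda>y. frechet_derivative f (at y) p) (at x) v +
       c * frechet_derivative (\<lambda>y. frechet_derivative f (at y) q) (at x) v) / 2)) (at x)"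
      by (auto intro!: derivative_eq_intros d)
    from frechet_derivative_eqI[OF this] show ?thesis
      unfolding wirtinger_def by metis
  qed
  show ?thesis
    unfolding wirtinger_def[of _ _ _ "wirtinger _ _ _ _"] D
    using mixed_derivatives_commute[OF assms] by (simp add: field_simps)
qed

section \<open>Fibre coordinates and contractions with them\<close>

lemma has_derivative_coord:
  "((\<lambda>y. snd y $ i) has_derivative (\<lambda>v. snd v $ i)) (at (x::('b::real_normed_vector) \<times> (complex^'n)))"
  by (auto intro!: derivative_eq_intros bounded_linear.has_derivative[OF bounded_linear_vec_nth])

lemma coord_differentiable:
  "(\<lambda>y::'b::real_normed_vector \<times> (complex^'n). snd y $ i) differentiable (at x)"
  "(\<lambda>y::'b::real_normed_vector \<times> (complex^'n). cnj (snd y $ i)) differentiable (at x)"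
  using has_derivative_coord[of i x] bounded_linear.has_derivative[OF bounded_linear_cnj]
    differentiableI by blast+

lemma coord_derivatives:
  "d_z k (\<lambda>y. snd y $ i) x = 0"
  "d_eta k (\<lambda>y. snd y $ i) x = of_bool (i = k)"
  "d_etabar k (\<lambda>y. snd y $ i) x = 0"
  "d_z k (\<lambda>y. cnj (snd y $ i)) x = 0"
  "d_eta k (\<lambda>y. cnj (snd y $ i)) x = 0"
  "d_etabar k (\<lambda>y. cnj (snd y $ i)) x = of_bool (i = k)"
  by (simp_all add: d_z_def d_eta_def d_etabar_def frechet_derivative_eqI[OF has_derivative_coord]
      frechet_derivative_eqI[OF bounded_linear.has_derivative[OF bounded_linear_cnj has_derivative_coord]]
      axis_def)

text \<open>The product rule for differentiating Euler relations: only \<open>d_eta\<close> sees the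
  fibre coordinates and only \<open>d_etabar\<close> their conjugates, which is where the extra
  \<open>f k x\<close> comes from.\<close>

lemma contraction_derivatives:
  assumes d: "\<And>i. f i differentiable (at x)"
  shows "d_z k (\<lambda>y. \<Sum>i\<in>UNIV. snd y $ i * f i y) x = (\<Sum>i\<in>UNIV. snd x $ i * d_z k (f i) x)"
    "d_eta k (\<lambda>y. \<Sum>i\<in>UNIV. snd y $ i * f i y) x = (\<Sum>i\<in>UNIV. snd x $ i * d_eta k (f i) x) + f k x"
    "d_etabar k (\<lambda>y. \<Sum>i\<in>UNIV. snd y $ i * f i y) x = (\<Sum>i\<in>UNIV. snd x $ i * d_etabar k (f i) x)"
    "d_z k (\<lambda>y. \<Sum>i\<in>UNIV. cnj (snd y $ i) * f i y) x = (\<Sum>i\<in>UNIV. cnj (snd x $ i) * d_z k (f i) x)"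
    "d_eta k (\<lambda>y. \<Sum>i\<in>UNIV. cnj (snd y $ i) * f i y) x = (\<Sum>i\<in>UNIV. cnj (snd x $ i) * d_eta k (f i) x)"
    "d_etabar k (\<lambda>y. \<Sum>i\<in>UNIV. cnj (snd y $ i) * f i y) x =
       (\<Sum>i\<in>UNIV. cnj (snd x $ i) * d_etabar k (f i) x) + f k x"
proof -
  note c = coord_derivatives[of k _ x, unfolded d_z_wirtinger d_eta_wirtinger d_etabar_wirtinger]
  note w = wirtinger_sum[OF differentiable_mult[OF coord_differentiable(1) d]]
    wirtinger_sum[OF differentiable_mult[OF coord_differentiable(2) d]]
    wirtinger_mult[OF coord_differentiable(1) d] wirtinger_mult[OF coord_differentiable(2) d]
  have s: "of_bool b * a = (if b then a else 0)" for a :: complex and b by simp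
  show "d_z k (\<lambda>y. \<Sum>i\<in>UNIV. snd y $ i * f i y) x = (\<Sum>i\<in>UNIV. snd x $ i * d_z k (f i) x)"
    "d_eta k (\<lambda>y. \<Sum>i\<in>UNIV. snd y $ i * f i y) x = (\<Sum>i\<in>UNIV. snd x $ i * d_eta k (f i) x) + f k x"
    "d_etabar k (\<lambda>y. \<Sum>i\<in>UNIV. snd y $ i * f i y) x = (\<Sum>i\<in>UNIV. snd x $ i * d_etabar k (f i) x)"
    "d_z k (\<lambda>y. \<Sum>i\<in>UNIV. cnj (snd y $ i) * f i y) x = (\<Sum>i\<in>UNIV. cnj (snd x $ i) * d_z k (f i) x)"
    "d_eta k (\<lambda>y. \<Sum>i\<in>UNIV. cnj (snd y $ i) * f i y) x = (\<Sum>i\<in>UNIV. cnj (snd x $ i) * d_eta k (f i) x)"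
    "d_etabar k (\<lambda>y. \<Sum>i\<in>UNIV. cnj (snd y $ i) * f i y) x =
       (\<Sum>i\<in>UNIV. cnj (snd x $ i) * d_etabar k (f i) x) + f k x"
    unfolding d_z_wirtinger d_eta_wirtinger d_etabar_wirtinger w c by (simp_all add: s sum.distrib)
qed

section \<open>Matrix inverses\<close>

lemma matrix_inv_mult:
  assumes "invertible A"
  shows "A ** matrix_inv A = mat 1" "matrix_inv A ** A = mat 1"
  using someI_ex[OF assms[unfolded invertible_def]] by (auto simp: matrix_inv_def)

lemma differentiable_prod:
  fixes f :: "'i \<Rightarrow> 'a::real_normed_vector \<Rightarrow> 'b::real_normed_field"
  assumes "\<And>i. i \<in> I \<Longrightarrow> f i differentiable (at x)"
  shows "(\<lambda>y. \<Prod>i\<in>I. f i y) differentiable (at x)"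
  using assms by (induction I rule: infinite_finite_induct) (auto intro: differentiable_mult)

lemma differentiable_det:
  fixes M :: "'a::real_normed_vector \<Rightarrow> ('b::real_normed_field)^'n^'n"
  assumes "\<And>i j. (\<lambda>y. M y $ i $ j) differentiable (at x)"
  shows "(\<lambda>y. det (M y)) differentiable (at x)"
  unfolding det_def
  by (intro differentiable_sum ballI finite_permutations differentiable_mult differentiable_const
      differentiable_prod assms) simp

text \<open>By Cramer's rule each entry of the inverse is a quotient of determinants.\<close>

lemma differentiable_matrix_inv:
  fixes M :: "'a::real_normed_vector \<Rightarrow> ('b::real_normed_field)^'n^'n"
  assumes "open S" "x \<in> S" and inv: "\<And>y. y \<in> S \<Longrightarrow> invertible (M y)"
    and d: "\<And>i j. (\<lambda>y. M y $ i $ j) differentiable (at x)"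
  shows "(\<lambda>y. matrix_inv (M y) $ m $ k) differentiable (at x)"
proof -
  \<comment> \<open>Column \<open>m\<close> is replaced by \<open>axis k 1\<close>, the right-hand
    side of the linear system that column \<open>k\<close> of the inverse solves.\<close>
  define R where "R = (\<lambda>y. \<chi> i j. if j = m then axis k 1 $ i else M y $ i $ j)"
  have eq: "det (R y) / det (M y) = matrix_inv (M y) $ m $ k" if y: "y \<in> S" for y
  proof -
    have "M y *v (matrix_inv (M y) *v axis k 1) = axis k 1"
      using matrix_inv_mult(1)[OF inv[OF y]] by (simp add: matrix_vector_mul_assoc)
    moreover have "det (M y) \<noteq> 0" using inv[OF y] invertible_det_nz by blast
    ultimately have "matrix_inv (M y) *v axis k 1 =
        (\<chi> m. det (\<chi> i j. if j = m then axis k 1 $ i else M y $ i $ j) / det (M y))"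
      using cramer by blast
    moreover have "(matrix_inv (M y) *v axis k 1) $ m = matrix_inv (M y) $ m $ k"
      by (simp add: matrix_vector_mult_def axis_def if_distrib[of "\<lambda>t. _ * t"] cong: if_cong)
    ultimately show ?thesis by (simp add: R_def)
  qed
  have "(\<lambda>y. det (R y) / det (M y)) differentiable (at x)"
  proof (intro differentiable_divide differentiable_det)
    show "(\<lambda>y. R y $ i $ j) differentiable (at x)" for i j
      using d by (cases "j = m") (simp_all add: R_def)
    show "det (M x) \<noteq> 0" using inv[OF assms(2)] invertible_det_nz by blast
  qed (rule d)
  then show ?thesis by (rule differentiable_transform_open[OF _ assms(1,2) eq])
qed

text \<open>With \<open>A\<close> the metric, lowering and raising an index undo each other.\<close>

lemma matrix_inv_contract:
  fixes A :: "'a::comm_ring_1^'n^'n"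
  assumes "invertible A"
  shows "(\<Sum>k\<in>UNIV. A $ k $ n * (\<Sum>m\<in>UNIV. matrix_inv A $ m $ k * c m)) = c n"
    and "(\<Sum>n\<in>UNIV. matrix_inv A $ n $ k * (\<Sum>m\<in>UNIV. A $ m $ n * c m)) = c k"
proof -
  have 1: "(\<Sum>k\<in>UNIV. A $ k $ n * matrix_inv A $ m $ k) = (if m = n then 1 else 0)" for m n
    using arg_cong[OF matrix_inv_mult(2)[OF assms], of "\<lambda>B. B $ m $ n"]
    by (simp add: matrix_matrix_mult_def mat_def mult.commute)
  have 2: "(\<Sum>n\<in>UNIV. A $ m $ n * matrix_inv A $ n $ k) = (if m = k then 1 else 0)" for m k
    using arg_cong[OF matrix_inv_mult(1)[OF assms], of "\<lambda>B. B $ m $ k"]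
    by (simp add: matrix_matrix_mult_def mat_def)
  have "(\<Sum>k\<in>UNIV. A $ k $ n * (\<Sum>m\<in>UNIV. matrix_inv A $ m $ k * c m)) =
      (\<Sum>m\<in>UNIV. (\<Sum>k\<in>UNIV. A $ k $ n * matrix_inv A $ m $ k) * c m)"
    unfolding sum_distrib_left sum_distrib_right by (subst sum.swap) (simp add: mult.assoc)
  also have "\<dots> = c n" unfolding 1 by (simp add: if_distrib[of "\<lambda>t. t * _"] cong: if_cong)
  finally show "(\<Sum>k\<in>UNIV. A $ k $ n * (\<Sum>m\<in>UNIV. matrix_inv A $ m $ k * c m)) = c n" .
  have "(\<Sum>n\<in>UNIV. matrix_inv A $ n $ k * (\<Sum>m\<in>UNIV. A $ m $ n * c m)) =
      (\<Sum>m\<in>UNIV. (\<Sum>n\<in>UNIV. A $ m $ n * matrix_inv A $ n $ k) * c m)"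
    unfolding sum_distrib_left sum_distrib_right by (subst sum.swap) (simp add: mult_ac)
  also have "\<dots> = c k" unfolding 2 by (simp add: if_distrib[of "\<lambda>t. t * _"] cong: if_cong)
  finally show "(\<Sum>n\<in>UNIV. matrix_inv A $ n $ k * (\<Sum>m\<in>UNIV. A $ m $ n * c m)) = c k" .
qed

section \<open>Homogeneity and the Kaehler condition in a bundle chart\<close>

text \<open>Isolates what the local computation uses: homogeneity enters as Euler's relation,
  positive definiteness as invertibility of the metric.\<close>

locale finsler_chart =
  fixes S :: "((complex^'n) \<times> (complex^'n::finite)) set" and L
  assumes open_S: "open S"
    and smooth_L: "smooth_on S L"
    and real_L: "x \<in> S \<Longrightarrow> cnj (L x) = L x"
    and euler: "x \<in> S \<Longrightarrow> (\<Sum>i\<in>UNIV. snd x $ i * d_eta i L x) = L x"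
    and invertible_metric: "x \<in> S \<Longrightarrow> invertible (metric L x)"
begin

lemma smooth_ops:
  assumes "smooth_on S f"
  shows "smooth_on S (d_z k f)" "smooth_on S (d_eta k f)" "smooth_on S (d_etabar k f)"
  unfolding d_z_wirtinger d_eta_wirtinger d_etabar_wirtinger
  using smooth_on_wirtinger[OF open_S assms] by auto

lemmas smooth = smooth_L smooth_ops

lemma cong_ops:
  assumes "x \<in> S" "\<And>y. y \<in> S \<Longrightarrow> f y = g y" "f differentiable (at x)"
  shows "d_z k f x = d_z k g x" "d_eta k f x = d_eta k g x" "d_etabar k f x = d_etabar k g x"
  unfolding d_z_wirtinger d_eta_wirtinger d_etabar_wirtinger
  using wirtinger_cong[OF open_S assms] by auto

lemma commute_ops:
  assumes "x \<in> S" "smooth_on S f"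
  shows "d_etabar h (d_z k f) x = d_z k (d_etabar h f) x"
    "d_etabar h (d_eta k f) x = d_eta k (d_etabar h f) x"
    "d_etabar h (d_etabar k f) x = d_etabar k (d_etabar h f) x"
    "d_eta h (d_eta k f) x = d_eta k (d_eta h f) x"
  unfolding d_z_wirtinger d_eta_wirtinger d_etabar_wirtinger
  using wirtinger_commute[OF open_S assms] by auto

lemma zero_ops: "d_z k (\<lambda>_. 0) x = 0" "d_eta k (\<lambda>_. 0) x = 0"
  by (simp_all add: d_z_def d_eta_def)

lemma etabar_L: "x \<in> S \<Longrightarrow> d_etabar k L x = cnj (d_eta k L x)"
proof -
  assume x: "x \<in> S"
  have "d_etabar k L x = d_etabar k (\<lambda>y. cnj (L y)) x"
    by (rule cong_ops(3)[OF x _ smooth_on_differentiable[OF smooth_L x]]) (simp add: real_L)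
  also have "\<dots> = cnj (d_eta k L x)"
    unfolding d_etabar_wirtinger d_eta_wirtinger
    by (subst wirtinger_cnj[OF smooth_on_differentiable[OF smooth_L x]]) simp
  finally show ?thesis .
qed

text \<open>As \<open>L\<close> is real, conjugation turns the holomorphic Hessian into the
  antiholomorphic one; this later transfers the vanishing of the first to the second.\<close>

lemma etabar_etabar_L: "x \<in> S \<Longrightarrow> d_etabar h (d_etabar k L) x = cnj (d_eta h (d_eta k L) x)"
proof -
  assume x: "x \<in> S"
  have "d_etabar h (d_etabar k L) x = d_etabar h (\<lambda>y. cnj (d_eta k L y)) x"
    by (rule cong_ops(3)[OF x etabar_L smooth_on_differentiable[OF _ x]]) (auto intro: smooth)
  also have "\<dots> = cnj (d_eta h (d_eta k L) x)"
    unfolding d_etabar_wirtinger d_eta_wirtinger[of h]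
    by (subst wirtinger_cnj[OF smooth_on_differentiable[OF _ x]]) (auto intro: smooth)
  finally show ?thesis .
qed

section \<open>Euler relations for the derivatives of \<open>L\<close>\<close>

lemma euler_bar: "x \<in> S \<Longrightarrow> (\<Sum>i\<in>UNIV. cnj (snd x $ i) * d_etabar i L x) = L x"
  using arg_cong[OF euler, of x cnj] by (simp add: etabar_L real_L)

lemma euler_etabar: "x \<in> S \<Longrightarrow> (\<Sum>i\<in>UNIV. snd x $ i * d_eta i (d_etabar j L) x) = d_etabar j L x"
proof -
  assume x: "x \<in> S"
  have "d_etabar j L x = d_etabar j (\<lambda>y. \<Sum>i\<in>UNIV. snd y $ i * d_eta i L y) x"
    by (rule cong_ops(3)[OF x _ smooth_on_differentiable[OF smooth_L x]]) (simp add: euler)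
  also have "\<dots> = (\<Sum>i\<in>UNIV. snd x $ i * d_etabar j (d_eta i L) x)"
    by (rule contraction_derivatives smooth_on_differentiable[OF _ x] smooth)+
  finally show ?thesis by (simp add: commute_ops[OF x smooth_L])
qed

text \<open>The metric coefficients have degree zero in the fibre variable: differentiating
  \<open>euler_etabar\<close> produces a term that cancels the other side.\<close>

lemma euler_eta_etabar:
  "x \<in> S \<Longrightarrow> (\<Sum>j\<in>UNIV. snd x $ j * d_eta i (d_eta j (d_etabar n L)) x) = 0"
proof -
  assume x: "x \<in> S"
  have "d_eta i (d_etabar n L) x =
      d_eta i (\<lambda>y. \<Sum>j\<in>UNIV. snd y $ j * d_eta j (d_etabar n L) y) x"
    by (rule cong_ops(2)[OF x _ smooth_on_differentiable[OF _ x]]) (auto simp: euler_etabar intro: smooth)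
  also have "\<dots> = (\<Sum>j\<in>UNIV. snd x $ j * d_eta i (d_eta j (d_etabar n L)) x) + d_eta i (d_etabar n L) x"
    by (rule contraction_derivatives smooth_on_differentiable[OF _ x] smooth)+
  finally show ?thesis by simp
qed

lemma euler_z_etabar:
  "x \<in> S \<Longrightarrow> (\<Sum>l\<in>UNIV. snd x $ l * d_z j (d_eta l (d_etabar n L)) x) = d_z j (d_etabar n L) x"
proof -
  assume x: "x \<in> S"
  have "d_z j (d_etabar n L) x =
      d_z j (\<lambda>y. \<Sum>l\<in>UNIV. snd y $ l * d_eta l (d_etabar n L) y) x"
    by (rule cong_ops(1)[OF x _ smooth_on_differentiable[OF _ x]]) (auto simp: euler_etabar intro: smooth)
  also have "\<dots> = (\<Sum>l\<in>UNIV. snd x $ l * d_z j (d_eta l (d_etabar n L)) x)"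
    by (rule contraction_derivatives smooth_on_differentiable[OF _ x] smooth)+
  finally show ?thesis by simp
qed

lemma euler_eta: "x \<in> S \<Longrightarrow> (\<Sum>i\<in>UNIV. snd x $ i * d_eta i (d_eta k L) x) = 0"
proof -
  assume x: "x \<in> S"
  have "d_eta k L x = d_eta k (\<lambda>y. \<Sum>i\<in>UNIV. snd y $ i * d_eta i L y) x"
    by (rule cong_ops(2)[OF x _ smooth_on_differentiable[OF smooth_L x]]) (simp add: euler)
  also have "\<dots> = (\<Sum>i\<in>UNIV. snd x $ i * d_eta k (d_eta i L) x) + d_eta k L x"
    by (rule contraction_derivatives smooth_on_differentiable[OF _ x] smooth)+
  finally show ?thesis by (simp add: commute_ops(4)[OF x smooth_L, of k])
qed

lemma euler_bar_eta:
  "x \<in> S \<Longrightarrow> (\<Sum>i\<in>UNIV. cnj (snd x $ i) * d_eta m (d_etabar i L) x) = d_eta m L x"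
proof -
  assume x: "x \<in> S"
  have "d_eta m L x = d_eta m (\<lambda>y. \<Sum>i\<in>UNIV. cnj (snd y $ i) * d_etabar i L y) x"
    by (rule cong_ops(2)[OF x _ smooth_on_differentiable[OF smooth_L x]]) (simp add: euler_bar)
  also have "\<dots> = (\<Sum>i\<in>UNIV. cnj (snd x $ i) * d_eta m (d_etabar i L) x)"
    by (rule contraction_derivatives smooth_on_differentiable[OF _ x] smooth)+
  finally show ?thesis by simp
qed

text \<open>Recovers the holomorphic Hessian from third derivatives, the form in which
  \<open>etabar_G_kernel\<close> uses it.\<close>

lemma euler_bar_eta_eta:
  "x \<in> S \<Longrightarrow> (\<Sum>i\<in>UNIV. cnj (snd x $ i) * d_eta k (d_eta m (d_etabar i L)) x) = d_eta k (d_eta m L) x"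
proof -
  assume x: "x \<in> S"
  have "d_eta k (d_eta m L) x =
      d_eta k (\<lambda>y. \<Sum>i\<in>UNIV. cnj (snd y $ i) * d_eta m (d_etabar i L) y) x"
    by (rule cong_ops(2)[OF x _ smooth_on_differentiable[OF _ x]]) (auto simp: euler_bar_eta intro: smooth)
  also have "\<dots> = (\<Sum>i\<in>UNIV. cnj (snd x $ i) * d_eta k (d_eta m (d_etabar i L)) x)"
    by (rule contraction_derivatives smooth_on_differentiable[OF _ x] smooth)+
  finally show ?thesis by simp
qed

lemma euler_bar_etabar:
  "x \<in> S \<Longrightarrow> (\<Sum>i\<in>UNIV. cnj (snd x $ i) * d_etabar i (d_etabar h L) x) = 0"
proof -
  assume x: "x \<in> S"
  have "d_etabar h L x = d_etabar h (\<lambda>y. \<Sum>i\<in>UNIV. cnj (snd y $ i) * d_etabar i L y) x"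
    by (rule cong_ops(3)[OF x _ smooth_on_differentiable[OF smooth_L x]]) (simp add: euler_bar)
  also have "\<dots> = (\<Sum>i\<in>UNIV. cnj (snd x $ i) * d_etabar h (d_etabar i L) x) + d_etabar h L x"
    by (rule contraction_derivatives smooth_on_differentiable[OF _ x] smooth)+
  finally show ?thesis by (simp add: commute_ops(3)[OF x smooth_L, of h])
qed

text \<open>The sum in \<open>euler_bar_etabar\<close> vanishes identically on \<open>S\<close>, and
  neither \<open>d_z\<close> nor \<open>d_eta\<close> acts on the conjugate fibre
  coordinates.\<close>

lemma euler_bar_etabar_derivatives:
  assumes x: "x \<in> S"
  shows "(\<Sum>i\<in>UNIV. cnj (snd x $ i) * d_z j (d_etabar i (d_etabar h L)) x) = 0"
    "(\<Sum>i\<in>UNIV. cnj (snd x $ i) * d_eta j (d_etabar i (d_etabar h L)) x) = 0"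
proof -
  let ?f = "\<lambda>y. \<Sum>i\<in>UNIV. cnj (snd y $ i) * d_etabar i (d_etabar h L) y"
  have "(\<Sum>i\<in>UNIV. cnj (snd x $ i) * d_z j (d_etabar i (d_etabar h L)) x) = d_z j ?f x"
    by (rule sym) (rule contraction_derivatives smooth_on_differentiable[OF _ x] smooth)+
  also have "\<dots> = d_z j (\<lambda>_. 0) x"
    by (rule cong_ops(1)[OF x, symmetric]) (simp_all add: euler_bar_etabar)
  finally show "(\<Sum>i\<in>UNIV. cnj (snd x $ i) * d_z j (d_etabar i (d_etabar h L)) x) = 0"
    by (simp add: zero_ops)
  have "(\<Sum>i\<in>UNIV. cnj (snd x $ i) * d_eta j (d_etabar i (d_etabar h L)) x) = d_eta j ?f x"
    by (rule sym) (rule contraction_derivatives smooth_on_differentiable[OF _ x] smooth)+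
  also have "\<dots> = d_eta j (\<lambda>_. 0) x"
    by (rule cong_ops(2)[OF x, symmetric]) (simp_all add: euler_bar_etabar)
  finally show "(\<Sum>i\<in>UNIV. cnj (snd x $ i) * d_eta j (d_etabar i (d_etabar h L)) x) = 0"
    by (simp add: zero_ops)
qed

section \<open>Connection and spray with lowered index\<close>

lemma metric_nth: "metric L x $ i $ j = d_eta i (d_etabar j L) x"
  by (simp add: metric_def)

text \<open>Lowering cancels the inverse metric in \<open>cf_N\<close>, and the contraction with the
  fibre coordinates collapses by \<open>euler_z_etabar\<close>. In this form the equation can be
  differentiated without a formula for the derivative of the inverse.\<close>

lemma lower_N:
  assumes x: "x \<in> S"
  shows "(\<Sum>k\<in>UNIV. d_eta k (d_etabar n L) x * cf_N L k j x) = d_z j (d_etabar n L) x"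
proof -
  have "cf_N L k j x = (\<Sum>m\<in>UNIV. metric_inv L x $ m $ k * d_z j (d_etabar m L) x)" for k
    unfolding cf_N_def euler_z_etabar[OF x, symmetric]
    by (simp add: sum_distrib_left metric_nth mult_ac)
  then show ?thesis
    using matrix_inv_contract(1)[OF invertible_metric[OF x], of n "\<lambda>m. d_z j (d_etabar m L) x"]
    by (simp add: metric_nth metric_inv_def)
qed

text \<open>\<open>G\<close> is twice the spray coefficient \<open>G\<^sup>i\<close> of the paper.\<close>

definition G :: "'n \<Rightarrow> (complex^'n) \<times> (complex^'n) \<Rightarrow> complex" where
  "G i x = (\<Sum>j\<in>UNIV. snd x $ j * cf_N L i j x)"

lemma spray_G: "spray L i = (\<lambda>x. G i x / 2)"
  by (simp add: fun_eq_iff spray_def G_def mult.commute)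

lemma lower_G:
  assumes x: "x \<in> S"
  shows "(\<Sum>k\<in>UNIV. d_eta k (d_etabar n L) x * G k x) = (\<Sum>j\<in>UNIV. snd x $ j * d_z j (d_etabar n L) x)"
  unfolding lower_N[OF x, symmetric] G_def sum_distrib_left
  by (subst sum.swap) (simp add: mult_ac)

text \<open>Licenses the product rule in \<open>lower_etabar_G\<close>; the delicate factor is the
  inverse metric, covered by \<open>differentiable_matrix_inv\<close>.\<close>

lemma differentiable_G:
  assumes x: "x \<in> S"
  shows "G k differentiable (at x)"
proof -
  have 1: "(\<lambda>y. metric_inv L y $ i $ j) differentiable (at x)" for i j
    unfolding metric_inv_def
  proof (rule differentiable_matrix_inv[OF open_S x invertible_metric])
    show "(\<lambda>y. metric L y $ i $ j) differentiable (at x)" for i j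
      unfolding metric_nth by (intro smooth_on_differentiable[OF _ x] smooth)
  qed
  show ?thesis unfolding G_def cf_N_def metric_nth
    by (intro differentiable_sum ballI differentiable_mult 1 smooth_on_differentiable[OF _ x] smooth
        coord_differentiable) simp_all
qed

lemma metric_nondegenerate:
  assumes "x \<in> S" "\<And>n. (\<Sum>k\<in>UNIV. d_eta k (d_etabar n L) x * c k) = 0"
  shows "c k = 0"
  using matrix_inv_contract(2)[OF invertible_metric[OF assms(1)], of k c] assms(2)
  by (simp add: metric_nth)

text \<open>Differentiate \<open>lower_G\<close>. Apart from \<open>G\<close>, the right side
  involves \<open>L\<close> only through \<open>d_etabar h (d_etabar n L)\<close>; this gives the
  symmetry in \<open>n\<close> and \<open>h\<close>, the vanishing under contraction, and the final
  open-set argument.\<close>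

lemma lower_etabar_G:
  assumes x: "x \<in> S"
  shows "(\<Sum>k\<in>UNIV. d_eta k (d_etabar n L) x * d_etabar h (G k) x) =
    (\<Sum>j\<in>UNIV. snd x $ j * d_z j (d_etabar h (d_etabar n L)) x) -
    (\<Sum>k\<in>UNIV. G k x * d_eta k (d_etabar h (d_etabar n L)) x)"
proof -
  have d: "d_eta k (d_etabar n L) differentiable (at x)" for k
    by (intro smooth_on_differentiable[OF _ x] smooth)
  have "(\<Sum>k\<in>UNIV. d_eta k (d_etabar n L) x * d_etabar h (G k) x +
      d_etabar h (d_eta k (d_etabar n L)) x * G k x) =
      d_etabar h (\<lambda>y. \<Sum>k\<in>UNIV. d_eta k (d_etabar n L) y * G k y) x"
    unfolding d_etabar_wirtinger[of h]
    by (simp add: wirtinger_sum wirtinger_mult differentiable_mult d differentiable_G x)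
  also have "\<dots> = d_etabar h (\<lambda>y. \<Sum>j\<in>UNIV. snd y $ j * d_z j (d_etabar n L) y) x"
    by (intro cong_ops(3)[OF x] lower_G differentiable_sum ballI differentiable_mult d
        differentiable_G x) simp_all
  also have "\<dots> = (\<Sum>j\<in>UNIV. snd x $ j * d_etabar h (d_z j (d_etabar n L)) x)"
    by (rule contraction_derivatives smooth_on_differentiable[OF _ x] smooth)+
  finally show ?thesis
    by (simp add: sum.distrib commute_ops(1,2)[OF x smooth(4)[OF smooth_L]] algebra_simps)
qed

lemma lower_etabar_G_sym:
  assumes x: "x \<in> S"
  shows "(\<Sum>k\<in>UNIV. d_eta k (d_etabar n L) x * d_etabar h (G k) x) =
    (\<Sum>k\<in>UNIV. d_eta k (d_etabar h L) x * d_etabar n (G k) x)"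
proof -
  have "d_z j (d_etabar h (d_etabar n L)) x = d_z j (d_etabar n (d_etabar h L)) x"
    "d_eta j (d_etabar h (d_etabar n L)) x = d_eta j (d_etabar n (d_etabar h L)) x" for j
    by (intro cong_ops[OF x] commute_ops smooth_on_differentiable[OF _ x] smooth; assumption)+
  then show ?thesis by (simp add: lower_etabar_G[OF x])
qed

text \<open>Exchanging sums lets the conjugate fibre coordinates meet derivatives of the
  antiholomorphic Hessian, which they annihilate.\<close>

lemma etabar_contract_lower:
  assumes x: "x \<in> S"
  shows "(\<Sum>h\<in>UNIV. cnj (snd x $ h) * (\<Sum>k\<in>UNIV. d_eta k (d_etabar n L) x * d_etabar h (G k) x)) = 0"
proof -
  have "(\<Sum>h\<in>UNIV. cnj (snd x $ h) * (\<Sum>j\<in>UNIV. snd x $ j * d_z j (d_etabar h (d_etabar n L)) x)) =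
      (\<Sum>j\<in>UNIV. snd x $ j * (\<Sum>h\<in>UNIV. cnj (snd x $ h) * d_z j (d_etabar h (d_etabar n L)) x))"
    unfolding sum_distrib_left by (subst sum.swap) (simp add: mult_ac)
  moreover have "(\<Sum>h\<in>UNIV. cnj (snd x $ h) * (\<Sum>k\<in>UNIV. G k x * d_eta k (d_etabar h (d_etabar n L)) x)) =
      (\<Sum>k\<in>UNIV. G k x * (\<Sum>h\<in>UNIV. cnj (snd x $ h) * d_eta k (d_etabar h (d_etabar n L)) x))"
    unfolding sum_distrib_left by (subst sum.swap) (simp add: mult_ac)
  ultimately show ?thesis
    by (simp add: lower_etabar_G[OF x] right_diff_distrib sum_subtractf
        euler_bar_etabar_derivatives[OF x])
qed

text \<open>Nondegeneracy of the metric removes the lowering from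
  \<open>etabar_contract_lower\<close>.\<close>

lemma etabar_contract_G:
  assumes x: "x \<in> S"
  shows "(\<Sum>h\<in>UNIV. cnj (snd x $ h) * d_etabar h (G k) x) = 0"
proof (rule metric_nondegenerate[OF x, where c = "\<lambda>k. \<Sum>h\<in>UNIV. cnj (snd x $ h) * d_etabar h (G k) x"])
  fix n
  have "(\<Sum>k\<in>UNIV. d_eta k (d_etabar n L) x * (\<Sum>h\<in>UNIV. cnj (snd x $ h) * d_etabar h (G k) x)) =
      (\<Sum>h\<in>UNIV. cnj (snd x $ h) * (\<Sum>k\<in>UNIV. d_eta k (d_etabar n L) x * d_etabar h (G k) x))"
    unfolding sum_distrib_left by (subst sum.swap) (simp add: mult_ac)
  then show "(\<Sum>k\<in>UNIV. d_eta k (d_etabar n L) x * (\<Sum>h\<in>UNIV. cnj (snd x $ h) * d_etabar h (G k) x)) = 0"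
    using etabar_contract_lower[OF x] by simp
qed

end

section \<open>Consequences of the Kaehler condition\<close>

locale kaehler_chart = finsler_chart +
  assumes kaehler: "x \<in> S \<Longrightarrow> (\<Sum>j\<in>UNIV. cf_torsion L i j k x * snd x $ j) = 0"
begin

lemma lower_cf_L:
  assumes x: "x \<in> S"
  shows "(\<Sum>i\<in>UNIV. d_eta i (d_etabar n L) x * cf_L L i j k x) =
    d_z k (d_eta j (d_etabar n L)) x - (\<Sum>i\<in>UNIV. cf_N L i k x * d_eta i (d_eta j (d_etabar n L)) x)"
  using matrix_inv_contract(1)[OF invertible_metric[OF x], of n "\<lambda>l. cf_delta L k (\<lambda>y. metric L y $ j $ l) x"]
  by (simp add: cf_L_def cf_delta_def metric_nth metric_inv_def)

text \<open>Lower the upper index of the contracted torsion. Its two connection terms simplify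
  differently, according to which lower index meets the fibre coordinates.\<close>

lemma kaehler_identity:
  assumes x: "x \<in> S"
  shows "d_z k (d_etabar n L) x = (\<Sum>j\<in>UNIV. snd x $ j * d_z j (d_eta k (d_etabar n L)) x) -
    (\<Sum>i\<in>UNIV. G i x * d_eta i (d_eta k (d_etabar n L)) x)"
proof -
  let ?g = "\<lambda>i. d_eta i (d_etabar n L)"
  \<comment> \<open>The contraction hits the metric index: the \<open>cf_N\<close> terms vanish by
    \<open>euler_eta_etabar\<close> and the rest collapses by \<open>euler_z_etabar\<close>.\<close>
  have A: "(\<Sum>j\<in>UNIV. snd x $ j * (\<Sum>i\<in>UNIV. ?g i x * cf_L L i j k x)) = d_z k (d_etabar n L) x"
  proof -
    have "(\<Sum>j\<in>UNIV. snd x $ j * (\<Sum>i\<in>UNIV. cf_N L i k x * d_eta i (?g j) x)) =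
        (\<Sum>i\<in>UNIV. cf_N L i k x * (\<Sum>j\<in>UNIV. snd x $ j * d_eta i (?g j) x))"
      unfolding sum_distrib_left by (subst sum.swap) (simp add: mult_ac)
    then show ?thesis
      by (simp add: lower_cf_L[OF x] right_diff_distrib sum_subtractf euler_z_etabar[OF x]
          euler_eta_etabar[OF x])
  qed
  \<comment> \<open>The contraction hits the differentiation index and turns \<open>cf_N\<close>
    into \<open>G\<close>.\<close>
  have "(\<Sum>j\<in>UNIV. snd x $ j * (\<Sum>i\<in>UNIV. cf_N L i j x * d_eta i (?g k) x)) =
      (\<Sum>i\<in>UNIV. G i x * d_eta i (?g k) x)"
    unfolding G_def sum_distrib_left sum_distrib_right by (subst sum.swap) (simp add: mult_ac)
  then have B: "(\<Sum>j\<in>UNIV. snd x $ j * (\<Sum>i\<in>UNIV. ?g i x * cf_L L i k j x)) =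
      (\<Sum>j\<in>UNIV. snd x $ j * d_z j (?g k) x) - (\<Sum>i\<in>UNIV. G i x * d_eta i (?g k) x)"
    by (simp add: lower_cf_L[OF x] right_diff_distrib sum_subtractf)
  have "0 = (\<Sum>i\<in>UNIV. ?g i x * (\<Sum>j\<in>UNIV. cf_torsion L i j k x * snd x $ j))"
    by (simp add: kaehler[OF x])
  also have "\<dots> = (\<Sum>j\<in>UNIV. snd x $ j * (\<Sum>i\<in>UNIV. ?g i x * cf_torsion L i j k x))"
    unfolding sum_distrib_left by (subst sum.swap) (simp add: mult_ac)
  also have "\<dots> = (\<Sum>j\<in>UNIV. snd x $ j * (\<Sum>i\<in>UNIV. ?g i x * cf_L L i j k x)) -
      (\<Sum>j\<in>UNIV. snd x $ j * (\<Sum>i\<in>UNIV. ?g i x * cf_L L i k j x))"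
    by (simp add: cf_torsion_def right_diff_distrib sum_subtractf)
  finally show ?thesis unfolding A B by simp
qed

text \<open>Differentiating \<open>kaehler_identity\<close> isolates the derivative of
  \<open>G\<close>; the other terms are written through \<open>d_etabar h (d_etabar n L)\<close>, so
  that their symmetry in \<open>h\<close> and \<open>n\<close> is visible.\<close>

lemma kaehler_identity_etabar:
  assumes x: "x \<in> S"
  shows "(\<Sum>i\<in>UNIV. d_etabar h (G i) x * d_eta i (d_eta k (d_etabar n L)) x) =
    (\<Sum>j\<in>UNIV. snd x $ j * d_z j (d_eta k (d_etabar h (d_etabar n L))) x) -
    (\<Sum>i\<in>UNIV. G i x * d_eta i (d_eta k (d_etabar h (d_etabar n L))) x) -
    d_z k (d_etabar h (d_etabar n L)) x"
proof -
  let ?gk = "d_eta k (d_etabar n L)"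
  \<comment> \<open>Moves \<open>d_etabar h\<close> inward until it acts directly on
    \<open>d_etabar n L\<close>.\<close>
  have c: "d_etabar h (d_z j ?gk) x = d_z j (d_eta k (d_etabar h (d_etabar n L))) x"
    "d_etabar h (d_eta j ?gk) x = d_eta j (d_eta k (d_etabar h (d_etabar n L))) x" for j
  proof -
    have s: "smooth_on S ?gk" "smooth_on S (d_etabar h ?gk)" by (intro smooth)+
    have e: "d_etabar h ?gk y = d_eta k (d_etabar h (d_etabar n L)) y" if "y \<in> S" for y
      by (intro commute_ops that smooth)
    show "d_etabar h (d_z j ?gk) x = d_z j (d_eta k (d_etabar h (d_etabar n L))) x"
      unfolding commute_ops(1)[OF x s(1)] by (rule cong_ops[OF x e smooth_on_differentiable[OF s(2) x]])
    show "d_etabar h (d_eta j ?gk) x = d_eta j (d_eta k (d_etabar h (d_etabar n L))) x"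
      unfolding commute_ops(2)[OF x s(1)] by (rule cong_ops[OF x e smooth_on_differentiable[OF s(2) x]])
  qed
  have d: "d_eta i ?gk differentiable (at x)" "d_z j ?gk differentiable (at x)" for i j
    by (intro smooth_on_differentiable[OF _ x] smooth)+
  have d1: "(\<lambda>y. \<Sum>j\<in>UNIV. snd y $ j * d_z j ?gk y) differentiable (at x)"
    by (intro differentiable_sum ballI differentiable_mult d coord_differentiable) simp
  have d2: "(\<lambda>y. \<Sum>i\<in>UNIV. G i y * d_eta i ?gk y) differentiable (at x)"
    by (intro differentiable_sum ballI differentiable_mult d differentiable_G x) simp
  have "d_z k (d_etabar h (d_etabar n L)) x = d_etabar h (d_z k (d_etabar n L)) x"
    by (rule commute_ops(1)[symmetric, OF x]) (intro smooth)
  also have "\<dots> = d_etabar h (\<lambda>y. (\<Sum>j\<in>UNIV. snd y $ j * d_z j ?gk y) - (\<Sum>i\<in>UNIV. G i y * d_eta i ?gk y)) x"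
    by (rule cong_ops(3)[OF x kaehler_identity smooth_on_differentiable[OF _ x]]) (auto intro: smooth)
  also have "\<dots> = d_etabar h (\<lambda>y. \<Sum>j\<in>UNIV. snd y $ j * d_z j ?gk y) x -
      d_etabar h (\<lambda>y. \<Sum>i\<in>UNIV. G i y * d_eta i ?gk y) x"
    unfolding d_etabar_wirtinger[of h] by (rule wirtinger_diff[OF d1 d2])
  also have "d_etabar h (\<lambda>y. \<Sum>j\<in>UNIV. snd y $ j * d_z j ?gk y) x =
      (\<Sum>j\<in>UNIV. snd x $ j * d_etabar h (d_z j ?gk) x)"
    by (rule contraction_derivatives d)+
  also have "d_etabar h (\<lambda>y. \<Sum>i\<in>UNIV. G i y * d_eta i ?gk y) x =
      (\<Sum>i\<in>UNIV. G i x * d_etabar h (d_eta i ?gk) x + d_etabar h (G i) x * d_eta i ?gk x)"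
    unfolding d_etabar_wirtinger[of h]
    by (simp add: wirtinger_sum wirtinger_mult differentiable_mult d differentiable_G x)
  finally show ?thesis by (simp add: c sum.distrib)
qed

lemma kaehler_identity_etabar_sym:
  assumes x: "x \<in> S"
  shows "(\<Sum>i\<in>UNIV. d_etabar h (G i) x * d_eta i (d_eta k (d_etabar n L)) x) =
    (\<Sum>i\<in>UNIV. d_etabar n (G i) x * d_eta i (d_eta k (d_etabar h L)) x)"
proof -
  have s: "smooth_on S (d_etabar h (d_etabar n L))" "smooth_on S (d_eta k (d_etabar h (d_etabar n L)))"
    by (intro smooth)+
  have e: "d_etabar h (d_etabar n L) y = d_etabar n (d_etabar h L) y" if "y \<in> S" for y
    by (intro commute_ops that smooth)
  have e': "d_eta k (d_etabar h (d_etabar n L)) y = d_eta k (d_etabar n (d_etabar h L)) y" if "y \<in> S" for y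
    by (rule cong_ops[OF that e smooth_on_differentiable[OF s(1) that]])
  have "d_z k (d_etabar h (d_etabar n L)) x = d_z k (d_etabar n (d_etabar h L)) x"
    by (rule cong_ops[OF x e smooth_on_differentiable[OF s(1) x]])
  moreover have "d_z j (d_eta k (d_etabar h (d_etabar n L))) x = d_z j (d_eta k (d_etabar n (d_etabar h L))) x" for j
    by (rule cong_ops[OF x e' smooth_on_differentiable[OF s(2) x]])
  moreover have "d_eta j (d_eta k (d_etabar h (d_etabar n L))) x = d_eta j (d_eta k (d_etabar n (d_etabar h L))) x" for j
    by (rule cong_ops[OF x e' smooth_on_differentiable[OF s(2) x]])
  ultimately show ?thesis by (simp add: kaehler_identity_etabar[OF x])
qed

text \<open>Write the Hessian as a contraction over \<open>n\<close> with the conjugate fibre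
  coordinates. Symmetry swaps \<open>n\<close> and \<open>h\<close>, so the contraction falls on the
  derivative of \<open>G\<close>, where it vanishes by \<open>etabar_contract_G\<close>.\<close>

lemma etabar_G_kernel:
  assumes x: "x \<in> S"
  shows "(\<Sum>i\<in>UNIV. d_etabar h (G i) x * d_eta i (d_eta k L) x) = 0"
proof -
  let ?C = "\<lambda>i n. d_eta i (d_eta k (d_etabar n L)) x"
  have "(\<Sum>i\<in>UNIV. d_etabar h (G i) x * d_eta i (d_eta k L) x) =
      (\<Sum>n\<in>UNIV. cnj (snd x $ n) * (\<Sum>i\<in>UNIV. d_etabar h (G i) x * ?C i n))"
    unfolding euler_bar_eta_eta[OF x, symmetric] sum_distrib_left
    by (subst sum.swap) (simp add: mult_ac)
  also have "\<dots> = (\<Sum>n\<in>UNIV. cnj (snd x $ n) * (\<Sum>i\<in>UNIV. d_etabar n (G i) x * ?C i h))"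
    by (simp add: kaehler_identity_etabar_sym[OF x, of h])
  also have "\<dots> = (\<Sum>i\<in>UNIV. (\<Sum>n\<in>UNIV. cnj (snd x $ n) * d_etabar n (G i) x) * ?C i h)"
    unfolding sum_distrib_left sum_distrib_right by (subst sum.swap) (simp add: mult_ac)
  finally show ?thesis by (simp add: etabar_contract_G[OF x])
qed

end

section \<open>Degenerate Hessian and dimension two\<close>

context kaehler_chart
begin

text \<open>Where \<open>d_etabar h (G i)\<close> does not vanish, an open condition, the Hessian \<open>L\<^sub>i\<^sub>k\<close> and
  hence its conjugate vanish identically, and so do all the terms of \<open>lower_etabar_G\<close>.\<close>

lemma etabar_G_eq_0I:
  assumes degenerate: "\<And>y h i k l. y \<in> S \<Longrightarrow> d_etabar h (G i) y \<noteq> 0 \<Longrightarrow> d_eta k (d_eta l L) y = 0"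
    and x: "x \<in> S"
  shows "d_etabar h (G i) x = 0"
proof (rule metric_nondegenerate[OF x])
  fix n
  let ?A = "\<lambda>y. \<Sum>k\<in>UNIV. d_eta k (d_etabar n L) y * d_etabar h (G k) y"
  let ?R = "\<lambda>y. (\<Sum>j\<in>UNIV. snd y $ j * d_z j (d_etabar h (d_etabar n L)) y) -
    (\<Sum>k\<in>UNIV. G k y * d_eta k (d_etabar h (d_etabar n L)) y)"
  show "?A x = 0"
  proof (rule ccontr)
    assume ne: "?A x \<noteq> 0"
    \<comment> \<open>\<open>?A\<close> contains derivatives of \<open>G\<close>, whose continuity
      has not been established; \<open>?R\<close> equals it on \<open>S\<close> and contains only
      \<open>G\<close> itself and derivatives of \<open>L\<close>.\<close>
    have "continuous_on S ?R"
      by (intro continuous_intros differentiable_imp_continuous_on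
          differentiable_at_imp_differentiable_on smooth_on_continuous smooth
          differentiable_G)
    then have "open (S \<inter> ?R -` (- {0}))"
      by (rule continuous_open_preimage[OF _ open_S]) auto
    moreover have "S \<inter> ?R -` (- {0}) = {y \<in> S. ?A y \<noteq> 0}"
      using lower_etabar_G by auto
    ultimately have U: "open {y \<in> S. ?A y \<noteq> 0}" by simp
    have xU: "x \<in> {y \<in> S. ?A y \<noteq> 0}" using x ne by simp
    have 0: "d_etabar h (d_etabar n L) y = 0" if y: "y \<in> {y \<in> S. ?A y \<noteq> 0}" for y
    proof -
      have "\<exists>k. d_etabar h (G k) y \<noteq> 0"
      proof (rule ccontr)
        assume "\<nexists>k. d_etabar h (G k) y \<noteq> 0"
        then have "?A y = 0" by simp
        then show False using y by simp
      qed
      then have "d_eta h (d_eta n L) y = 0" using degenerate[of y] y by blast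
      then show ?thesis using y by (simp add: etabar_etabar_L)
    qed
    \<comment> \<open>The Hessian entry agrees with the zero function on an open set around
      \<open>x\<close>, so its first derivatives vanish there too.\<close>
    have "d_z j (d_etabar h (d_etabar n L)) x = 0" "d_eta j (d_etabar h (d_etabar n L)) x = 0" for j
      using wirtinger_cong[OF U xU, of "\<lambda>_. 0" "d_etabar h (d_etabar n L)"] 0
      unfolding d_z_wirtinger d_eta_wirtinger by (simp_all add: wirtinger_def[of _ _ _ "\<lambda>_. 0"])
    then show False using ne lower_etabar_G[OF x] by simp
  qed
qed

end

text \<open>In dimension two a nonzero covector annihilates only a line, so the derivative of
  \<open>G\<close> is parallel to the fibre vector wherever the Hessian is nonzero.\<close>

lemma etabar_spray_dim2:
  fixes S :: "((complex^2) \<times> (complex^2)) set"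
  assumes K: "kaehler_chart S L" and nz: "\<And>x. x \<in> S \<Longrightarrow> L x \<noteq> 0" and x: "x \<in> S"
  shows "d_etabar h (spray L i) x = 0"
proof -
  interpret kaehler_chart S L by (rule K)
  have "d_eta k (d_eta l L) y = 0" if y: "y \<in> S" and P: "d_etabar h (G i) y \<noteq> 0" for y h i k l
  proof (rule ccontr)
    assume M: "d_eta k (d_eta l L) y \<noteq> 0"
    let ?\<eta> = "\<lambda>i. snd y $ i" and ?P = "\<lambda>i. d_etabar h (G i) y" and ?M = "\<lambda>i. d_eta i (d_eta l L) y"
    have eqs: "?P 1 * ?M 1 + ?P 2 * ?M 2 = 0" "?\<eta> 1 * ?M 1 + ?\<eta> 2 * ?M 2 = 0"
      using etabar_G_kernel[OF y, of h l] euler_eta[OF y, of l] by (simp_all add: sum_2)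
    \<comment> \<open>Elimination: each entry of the Hessian column \<open>l\<close> times the
      determinant of the two kernel vectors is zero.\<close>
    have "?M 1 * (?P 1 * ?\<eta> 2 - ?P 2 * ?\<eta> 1) = 0" "?M 2 * (?P 1 * ?\<eta> 2 - ?P 2 * ?\<eta> 1) = 0"
      using eqs by algebra+
    moreover have "?M 1 \<noteq> 0 \<or> ?M 2 \<noteq> 0" using M exhaust_2[of k] by metis
    ultimately have par: "?P 1 * ?\<eta> 2 = ?P 2 * ?\<eta> 1" by auto
    \<comment> \<open>A zero fibre vector would force \<open>L y = 0\<close> by Euler's
      relation.\<close>
    have "?\<eta> 1 \<noteq> 0 \<or> ?\<eta> 2 \<noteq> 0"
      using nz[OF y] euler[OF y] by (auto simp: sum_2)
    then obtain p where p: "?P j = p * ?\<eta> j" for j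
    proof
      assume "?\<eta> 1 \<noteq> 0"
      then have "?P j = ?P 1 / ?\<eta> 1 * ?\<eta> j" for j
        using par exhaust_2[of j] by (auto simp: field_simps)
      then show thesis by (rule that)
    next
      assume "?\<eta> 2 \<noteq> 0"
      then have "?P j = ?P 2 / ?\<eta> 2 * ?\<eta> j" for j
        using par exhaust_2[of j] by (auto simp: field_simps)
      then show thesis by (rule that)
    qed
    \<comment> \<open>By symmetry of the lowered derivative, contracting over \<open>n\<close> also
      gives zero; inserting the multiple \<open>p\<close> of the fibre vector turns the same sum
      into \<open>p * L y\<close>.\<close>
    have "0 = (\<Sum>n\<in>UNIV. cnj (?\<eta> n) * (\<Sum>k\<in>UNIV. d_eta k (d_etabar n L) y * ?P k))"
      unfolding lower_etabar_G_sym[OF y, of _ h] by (rule etabar_contract_lower[OF y, symmetric])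
    also have "\<dots> = p * (\<Sum>n\<in>UNIV. cnj (?\<eta> n) * (\<Sum>k\<in>UNIV. ?\<eta> k * d_eta k (d_etabar n L) y))"
      by (simp add: p sum_distrib_left mult_ac)
    also have "\<dots> = p * L y"
      by (simp add: euler_etabar[OF y] euler_bar[OF y])
    finally have "p = 0" using nz[OF y] by simp
    then show False using p[of i] P by simp
  qed
  from etabar_G_eq_0I[OF this x] have "d_etabar h (G i) x = 0" .
  moreover have "d_etabar h (\<lambda>y. G i y / 2) x = d_etabar h (G i) x / 2"
    by (simp add: d_etabar_def
        frechet_derivative_linear_image[OF bounded_linear_divide differentiable_G[OF x]] field_simps)
  ultimately show ?thesis by (simp add: spray_G)
qed

section \<open>Real derivatives along fibres: Euler's relation and holomorphy\<close>

lemma linear_eta_expansion: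
  assumes "linear D"
  shows "D (0, v) = (\<Sum>k\<in>UNIV. Re (v $ k) *\<^sub>R D (0, axis k 1) + Im (v $ k) *\<^sub>R D (0, axis k \<i>))"
proof -
  have "v = (\<Sum>k\<in>UNIV. Re (v $ k) *\<^sub>R axis k 1 + Im (v $ k) *\<^sub>R axis k \<i>)"
    by (auto simp: vec_eq_iff axis_def sum.distrib complex_eq_iff if_distrib[of "\<lambda>t. _ *\<^sub>R t"] cong: if_cong)
  then have "(0, v) = (\<Sum>k\<in>UNIV. Re (v $ k) *\<^sub>R (0, axis k 1) + Im (v $ k) *\<^sub>R (0, axis k \<i>))"
    by (auto simp: prod_eq_iff fst_sum snd_sum)
  from arg_cong[OF this, of D] show ?thesis
    by (simp only: linear_sum[OF assms] linear_add[OF assms] linear_cmul[OF assms])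
qed

text \<open>Reduces Wirtinger contractions to real derivatives along \<open>v\<close> and
  \<open>\<i> *s v\<close>; the first formula serves Euler's relation, the second the Cauchy-Riemann
  equations.\<close>

lemma eta_contraction:
  fixes f :: "(complex^'n) \<times> (complex^'n::finite) \<Rightarrow> complex"
  assumes "f differentiable (at x)"
  shows "(\<Sum>k\<in>UNIV. v $ k * d_eta k f x) =
      (frechet_derivative f (at x) (0, v) - \<i> * frechet_derivative f (at x) (0, \<i> *s v)) / 2"
    and "(\<Sum>k\<in>UNIV. cnj (v $ k) * d_etabar k f x) =
      (frechet_derivative f (at x) (0, v) + \<i> * frechet_derivative f (at x) (0, \<i> *s v)) / 2"
proof -
  let ?D = "frechet_derivative f (at x)"
  have s: "(\<Sum>k\<in>UNIV. a k / 2 + c * b k) = (\<Sum>k\<in>UNIV. a k) / 2 + c * (\<Sum>k\<in>UNIV. b k)"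
    for a b :: "'n \<Rightarrow> complex" and c
    by (simp add: sum.distrib sum_distrib_left sum_divide_distrib)
  note e = linear_eta_expansion[OF linear_frechet_derivative[OF assms]]
  have "v $ k * d_eta k f x = (Re (v $ k) *\<^sub>R ?D (0, axis k 1) + Im (v $ k) *\<^sub>R ?D (0, axis k \<i>)) / 2 -
      \<i> / 2 * (Re ((\<i> *s v) $ k) *\<^sub>R ?D (0, axis k 1) + Im ((\<i> *s v) $ k) *\<^sub>R ?D (0, axis k \<i>))" for k
    by (simp add: d_eta_def complex_eq_iff field_simps)
  then show "(\<Sum>k\<in>UNIV. v $ k * d_eta k f x) = (?D (0, v) - \<i> * ?D (0, \<i> *s v)) / 2"
    unfolding e[of v] e[of "\<i> *s v"]
    by (simp only: sum_subtractf sum_distrib_left[symmetric] sum_divide_distrib[symmetric])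
      (simp add: diff_divide_distrib)
  have "cnj (v $ k) * d_etabar k f x =
      (Re (v $ k) *\<^sub>R ?D (0, axis k 1) + Im (v $ k) *\<^sub>R ?D (0, axis k \<i>)) / 2 +
      \<i> / 2 * (Re ((\<i> *s v) $ k) *\<^sub>R ?D (0, axis k 1) + Im ((\<i> *s v) $ k) *\<^sub>R ?D (0, axis k \<i>))" for k
    by (simp add: d_etabar_def complex_eq_iff field_simps)
  then show "(\<Sum>k\<in>UNIV. cnj (v $ k) * d_etabar k f x) = (?D (0, v) + \<i> * ?D (0, \<i> *s v)) / 2"
    unfolding e[of v] e[of "\<i> *s v"]
    by (simp only: s) (simp add: add_divide_distrib)
qed

text \<open>Along \<open>(1 + t w) *s \<eta>\<close> the function is multiplied by the squared
  modulus of \<open>1 + t w\<close>, whose derivative at \<open>t = 0\<close> is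
  \<open>2 * Re w\<close>.\<close>

lemma euler_homogeneous:
  assumes d: "f differentiable (at (z, \<eta>))"
    and hom: "\<And>a. f (z, a *s \<eta>) = complex_of_real ((cmod a)\<^sup>2) * f (z, \<eta>)"
  shows "(\<Sum>k\<in>UNIV. \<eta> $ k * d_eta k f (z, \<eta>)) = f (z, \<eta>)"
proof -
  have D: "frechet_derivative f (at (z, \<eta>)) (0, w *s \<eta>) = 2 * Re w * f (z, \<eta>)" for w
  proof -
    let ?c = "\<lambda>t::real. (z, \<eta> + t *\<^sub>R (w *s \<eta>))"
    have 1: "(?c has_derivative (\<lambda>t. (0, t *\<^sub>R (w *s \<eta>)))) (at 0)"
      by (auto intro!: derivative_eq_intros)
    have c1: "((\<lambda>t. f (?c t)) has_derivative (\<lambda>t. frechet_derivative f (at (z, \<eta>)) (0, t *\<^sub>R (w *s \<eta>)))) (at 0)"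
      using has_derivative_compose[OF 1, of f] has_frechet_derivative[OF d] by simp
    have eq: "(\<lambda>t. f (?c t)) = (\<lambda>t. complex_of_real (1 + 2 * t * Re w + t\<^sup>2 * (cmod w)\<^sup>2) * f (z, \<eta>))"
    proof
      fix t
      have "\<eta> + t *\<^sub>R (w *s \<eta>) = (1 + of_real t * w) *s \<eta>"
        by (auto simp: vec_eq_iff) (simp add: algebra_simps scaleR_conv_of_real)
      moreover have "(cmod (1 + of_real t * w))\<^sup>2 = 1 + 2 * t * Re w + t\<^sup>2 * (cmod w)\<^sup>2"
        unfolding cmod_power2 by (simp add: power2_eq_square algebra_simps)
      ultimately show "f (?c t) = complex_of_real (1 + 2 * t * Re w + t\<^sup>2 * (cmod w)\<^sup>2) * f (z, \<eta>)"
        by (simp only: hom)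
    qed
    have c2: "((\<lambda>t. complex_of_real (1 + 2 * t * Re w + t\<^sup>2 * (cmod w)\<^sup>2) * f (z, \<eta>)) has_derivative
        (\<lambda>t. complex_of_real (2 * t * Re w) * f (z, \<eta>))) (at 0)"
      by (auto intro!: derivative_eq_intros)
    have "(\<lambda>t. frechet_derivative f (at (z, \<eta>)) (0, t *\<^sub>R (w *s \<eta>))) =
        (\<lambda>t. complex_of_real (2 * t * Re w) * f (z, \<eta>))"
      using c1 unfolding eq by (rule has_derivative_unique[OF _ c2])
    from fun_cong[OF this, of 1] show ?thesis by simp
  qed
  \<comment> \<open>Direction 1 contributes twice the value of \<open>f\<close>, direction
    \<open>\<i>\<close> contributes nothing.\<close>
  show ?thesis
    using D[of 1] D[of \<i>] by (simp add: eta_contraction(1)[OF d])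
qed

lemma hermitian_pos_def_invertible:
  assumes "hermitian_pos_def H"
  shows "invertible H"
proof -
  have "w = 0" if w: "H *v w = 0" for w
  proof (rule ccontr)
    assume "w \<noteq> 0"
    \<comment> \<open>In \<open>hermitian_pos_def\<close> the second index meets the conjugated
      vector, so testing on the conjugate of \<open>w\<close> makes \<open>H *v w\<close>
      appear.\<close>
    then have "(\<chi> i. cnj (w $ i)) \<noteq> 0" by (simp add: vec_eq_iff)
    then have "Re (\<Sum>i\<in>UNIV. \<Sum>j\<in>UNIV. H $ i $ j * cnj (w $ i) * w $ j) > 0"
      using conjunct2[OF assms[unfolded hermitian_pos_def_def], rule_format, of "\<chi> i. cnj (w $ i)"]
      by simp
    moreover have "(\<Sum>i\<in>UNIV. \<Sum>j\<in>UNIV. H $ i $ j * cnj (w $ i) * w $ j) =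
        (\<Sum>i\<in>UNIV. cnj (w $ i) * (H *v w) $ i)"
      by (simp add: matrix_vector_mult_def sum_distrib_left mult_ac)
    ultimately show False by (simp add: w)
  qed
  then show ?thesis
    unfolding invertible_left_inverse matrix_left_invertible_ker by blast
qed

text \<open>The vanishing of all \<open>d_etabar h\<close> is the Cauchy-Riemann system: the real
  derivative along the fibre commutes with multiplication by \<open>\<i>\<close>, hence is complex
  linear.\<close>

lemma holomorphic_in_eta:
  fixes f :: "'i::finite \<Rightarrow> (complex^'n) \<times> (complex^'n) \<Rightarrow> complex"
  assumes d: "\<And>i \<eta>. \<eta> \<in> U \<Longrightarrow> f i differentiable (at (z, \<eta>))"
    and cr: "\<And>i h \<eta>. \<eta> \<in> U \<Longrightarrow> d_etabar h (f i) (z, \<eta>) = 0"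
  shows "holomorphic_map_on U (\<lambda>\<eta>. \<chi> i. f i (z, \<eta>))"
  unfolding holomorphic_map_on_def
proof
  fix \<eta> assume \<eta>: "\<eta> \<in> U"
  let ?D = "\<lambda>i v. frechet_derivative (f i) (at (z, \<eta>)) (0, v)"
  have ax: "bounded_linear (axis i :: complex \<Rightarrow> complex^'i)" for i
    by (auto simp: linear_conv_bounded_linear[symmetric] linear_iff vec_eq_iff axis_def)
  have vec: "(\<chi> i. g i) = (\<Sum>i\<in>UNIV. axis i (g i))" for g :: "'i \<Rightarrow> complex"
    by (simp add: vec_eq_iff axis_def if_distrib cong: if_cong)
  have pair: "((\<lambda>\<eta>. (z, \<eta>)) has_derivative (\<lambda>v. (0, v))) (at \<eta>)"
    by (auto intro!: derivative_eq_intros)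
  have lin: "linear (frechet_derivative (f i) (at (z, \<eta>)))" for i
    by (rule linear_frechet_derivative[OF d[OF \<eta>]])
  have "((\<lambda>\<eta>. f i (z, \<eta>)) has_derivative ?D i) (at \<eta>)" for i
    by (rule has_derivative_compose[OF pair has_frechet_derivative[OF d[OF \<eta>]]])
  then have "((\<lambda>\<eta>. \<chi> i. f i (z, \<eta>)) has_derivative (\<lambda>v. \<chi> i. ?D i v)) (at \<eta>)"
    unfolding vec by (intro has_derivative_sum bounded_linear.has_derivative[OF ax])
  moreover have "(\<chi> i. ?D i (c *s v)) = c *s (\<chi> i. ?D i v)" for c v
  proof -
    have "?D i (c *s v) = c * ?D i v" for i
    proof -
      have I: "?D i (\<i> *s v) = \<i> * ?D i v"
        using eta_contraction(2)[OF d[OF \<eta>], of v i] by (simp add: cr[OF \<eta>] complex_eq_iff)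
      have "(0, c *s v) = Re c *\<^sub>R (0, v) + Im c *\<^sub>R (0::complex^'n, \<i> *s v)"
        by (auto simp: vec_eq_iff complex_eq_iff)
      then have "?D i (c *s v) = Re c *\<^sub>R ?D i v + Im c *\<^sub>R ?D i (\<i> *s v)"
        by (simp only: linear_add[OF lin] linear_cmul[OF lin])
      then show ?thesis unfolding I by (simp add: complex_eq_iff)
    qed
    then show ?thesis by (simp add: vec_eq_iff)
  qed
  ultimately show "\<exists>f'. ((\<lambda>\<eta>. \<chi> i. f i (z, \<eta>)) has_derivative f') (at \<eta>) \<and> (\<forall>c v. f' (c *s v) = c *s f' v)"
    by blast
qed

section \<open>Finsler functions in the charts of a complex manifold\<close>

locale complex_atlas =
  fixes X :: "'a topology" and A :: "('a, 'n::finite) chart set"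
  assumes manifold: "complex_manifold X A"
begin

lemma chart_homeo:
  assumes "c \<in> A"
  shows "openin X (fst c)" "open (chart_image c)" "inj_on (snd c) (fst c)"
    "homeomorphic_map (subtopology X (fst c)) (top_of_set (chart_image c)) (snd c)"
proof -
  have c: "is_chart X c" using manifold assms unfolding complex_manifold_def by blast
  then show o: "openin X (fst c)" and "open (chart_image c)"
    and h: "homeomorphic_map (subtopology X (fst c)) (top_of_set (chart_image c)) (snd c)"
    unfolding is_chart_def by auto
  show "inj_on (snd c) (fst c)"
    using homeomorphic_imp_injective_map[OF h] openin_subset[OF o] by (simp add: Int_absorb1)
qed

lemma chart_inv_left: "c \<in> A \<Longrightarrow> p \<in> fst c \<Longrightarrow> chart_inv c (snd c p) = p"
  unfolding chart_inv_def by (rule inv_into_f_f[OF chart_homeo(3)])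

lemma chart_inv_right:
  assumes "z \<in> chart_image c"
  shows "chart_inv c z \<in> fst c" "snd c (chart_inv c z) = z"
  using assms unfolding chart_inv_def chart_image_def by (auto intro: inv_into_into f_inv_into_f)

lemma open_chart_image_Int:
  assumes c: "c \<in> A" and V: "openin X V" "V \<subseteq> fst c"
  shows "open (snd c ` V)"
proof -
  have "openin (subtopology X (fst c)) V"
    using V by (metis Int_absorb1 openin_subtopology_Int2 inf_commute)
  then have "openin (top_of_set (chart_image c)) (snd c ` V)"
    using homeomorphic_imp_open_map[OF chart_homeo(4)[OF c]] by (simp add: open_map_def)
  then show ?thesis using openin_open_trans chart_homeo(2)[OF c] by blast
qed

lemma transition_derivative:
  assumes "c \<in> A" "d \<in> A" "z \<in> chart_image c" "chart_inv c z \<in> fst d"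
  shows "(transition c d has_derivative frechet_derivative (transition c d) (at z)) (at z)"
    "frechet_derivative (transition c d) (at z) (a *s v) =
     a *s frechet_derivative (transition c d) (at z) v"
proof -
  have "z \<in> snd c ` (fst c \<inter> fst d)"
    using chart_inv_right[OF assms(3)] assms(4) by (metis IntI image_eqI)
  then obtain D where D: "(transition c d has_derivative D) (at z)" "\<And>c v. D (c *s v) = c *s D v"
    using manifold assms(1,2) unfolding complex_manifold_def holomorphic_map_on_def by meson
  show "(transition c d has_derivative frechet_derivative (transition c d) (at z)) (at z)"
    "frechet_derivative (transition c d) (at z) (a *s v) =
     a *s frechet_derivative (transition c d) (at z) v"
    unfolding frechet_derivative_eqI[OF D(1)] by (simp_all add: D)
qed

text \<open>The chain rule applied to the cocycle identity of the transition maps.\<close>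

lemma transition_chain:
  assumes c: "c \<in> A" "d \<in> A" "e \<in> A" and z: "z \<in> chart_image c"
    and p: "chart_inv c z \<in> fst d \<inter> fst e"
  shows "frechet_derivative (transition c e) (at z) v =
    frechet_derivative (transition d e) (at (snd d (chart_inv c z)))
      (frechet_derivative (transition c d) (at z) v)"
proof -
  let ?p = "chart_inv c z"
  have d: "snd d ?p \<in> chart_image d" "chart_inv d (snd d ?p) = ?p"
    using p chart_inv_left[OF c(2)] by (auto simp: chart_image_def)
  have eq: "transition d e (transition c d w) = transition c e w"
    if w: "w \<in> snd c ` (fst c \<inter> fst d \<inter> fst e)" for w
    using w by (auto simp: transition_def chart_inv_left[OF c(1)] chart_inv_left[OF c(2)])
  \<comment> \<open>The cocycle identity holds on the image of the triple overlap, whose openness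
    allows derivatives at \<open>z\<close> to be compared.\<close>
  have op: "open (snd c ` (fst c \<inter> fst d \<inter> fst e))"
    using chart_homeo(1) c by (intro open_chart_image_Int openin_Int) auto
  have zV: "z \<in> snd c ` (fst c \<inter> fst d \<inter> fst e)"
    using p chart_inv_right[OF z] by (metis IntD1 IntD2 IntI image_eqI)
  have D1: "(transition c d has_derivative frechet_derivative (transition c d) (at z)) (at z)"
    using transition_derivative(1) c z p by blast
  have "(transition d e has_derivative frechet_derivative (transition d e) (at (snd d ?p))) (at (snd d ?p))"
    using transition_derivative(1)[OF c(2,3) d(1)] d(2) p by simp
  then have D2: "(transition d e has_derivative frechet_derivative (transition d e) (at (snd d ?p)))
      (at (transition c d z))"
    by (simp add: transition_def)
  note D = has_derivative_compose[OF D1 D2]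
  show ?thesis
    by (simp add: frechet_derivative_eqI[OF has_derivative_transform_within_open[OF D op zV eq]])
qed

text \<open>The axioms on \<open>F\<close> quantify over \<open>tangent_bundle\<close>, so
  coordinate vectors must lie in it; compatibility between charts is
  \<open>transition_chain\<close>.\<close>

lemma tvec_of_in_bundle:
  assumes "c \<in> A" "z \<in> chart_image c"
  shows "tvec_of A c (z, \<eta>) \<in> tangent_bundle A"
proof -
  obtain v where v: "tvec_of A c (z, \<eta>) = (chart_inv c z, v)"
    and v_def: "v = (\<lambda>d. if d \<in> A \<and> chart_inv c z \<in> fst d
      then frechet_derivative (transition c d) (at z) \<eta> else 0)"
    by (simp add: tvec_of_def)
  have "chart_inv c z \<in> (\<Union>c\<in>A. fst c)"
    using chart_inv_right(1)[OF assms(2)] assms(1) by blast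
  moreover have "v e = frechet_derivative (transition d e) (at (snd d (chart_inv c z))) (v d)"
    if "d \<in> A" "e \<in> A" "chart_inv c z \<in> fst d \<inter> fst e" for d e
    using that by (simp add: v_def transition_chain[OF assms(1) that(1,2) assms(2) that(3)])
  moreover have "v d = 0" if "\<not> (d \<in> A \<and> chart_inv c z \<in> fst d)" for d
    using that unfolding v_def by argo
  ultimately show ?thesis
    unfolding v tangent_bundle_def by blast
qed

lemma tvec_of_scale:
  assumes "c \<in> A" "z \<in> chart_image c"
  shows "tvec_of A c (z, a *s \<eta>) = tscale a (tvec_of A c (z, \<eta>))"
proof -
  have "(if d \<in> A \<and> chart_inv c z \<in> fst d then frechet_derivative (transition c d) (at z) (a *s \<eta>) else 0) =
      a *s (if d \<in> A \<and> chart_inv c z \<in> fst d then frechet_derivative (transition c d) (at z) \<eta> else 0)" for d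
    by (simp add: transition_derivative(2)[OF assms(1) _ assms(2)])
  then show ?thesis by (simp add: tvec_of_def tscale_def)
qed

text \<open>\<open>transition c c\<close> is the identity near \<open>z\<close>. Hence a nonzero
  \<open>\<eta>\<close> represents a nonzero tangent vector.\<close>

lemma tvec_of_self:
  assumes "c \<in> A" "z \<in> chart_image c"
  shows "snd (tvec_of A c (z, \<eta>)) c = \<eta>"
proof -
  have "(transition c c has_derivative (\<lambda>v. v)) (at z)"
    by (rule has_derivative_transform_within_open[OF has_derivative_ident chart_homeo(2)[OF assms(1)] assms(2)])
      (simp add: transition_def chart_inv_right)
  then show ?thesis
    using assms(1) chart_inv_right(1)[OF assms(2)] by (simp add: tvec_of_def frechet_derivative_eqI)
qed

end

text \<open>From global axioms to a chart: scaling gives Euler's relation, positive definiteness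
  gives invertibility, and \<open>F\<close> vanishes only on zero vectors.\<close>

lemma finsler_chart_local_L:
  assumes F: "complex_finsler X A F" and c: "c \<in> A"
  shows "finsler_chart (slit c) (local_L A F c)"
    and "x \<in> slit c \<Longrightarrow> local_L A F c x \<noteq> 0"
proof -
  interpret complex_atlas X A
    using F by (unfold_locales) (simp add: complex_finsler_def)
  have zero: "\<And>x. x \<in> tangent_bundle A \<Longrightarrow> F x = 0 \<longleftrightarrow> snd x = (\<lambda>c. 0)"
    and hom: "\<And>x a. x \<in> tangent_bundle A \<Longrightarrow> F (tscale a x) = cmod a * F x"
    and sm: "smooth_on (slit c) (\<lambda>x. (F (tvec_of A c x))\<^sup>2)"
    and pos: "\<And>x. x \<in> slit c \<Longrightarrow> hermitian_pos_def (metric (local_L A F c) x)"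
    using F c unfolding complex_finsler_def by blast+
  have op: "open (slit c)"
    unfolding slit_def using chart_homeo(2)[OF c] by (intro open_Times) auto
  have smL: "smooth_on (slit c) (local_L A F c)"
    using smooth_on_linear_image[OF op bounded_linear_of_real sm]
    by (simp add: local_L_def[abs_def])
  show "finsler_chart (slit c) (local_L A F c)"
  proof
    fix x assume x: "x \<in> slit c"
    obtain z \<eta> where x_eq: "x = (z, \<eta>)" and z: "z \<in> chart_image c"
      using x by (auto simp: slit_def)
    have "local_L A F c (z, a *s \<eta>) = complex_of_real ((cmod a)\<^sup>2) * local_L A F c (z, \<eta>)" for a
      by (simp add: local_L_def tvec_of_scale[OF c z] hom[OF tvec_of_in_bundle[OF c z]] power_mult_distrib)
    then show "(\<Sum>i\<in>UNIV. snd x $ i * d_eta i (local_L A F c) x) = local_L A F c x"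
      using euler_homogeneous smooth_on_differentiable[OF smL x] unfolding x_eq by auto
  qed (use op smL pos hermitian_pos_def_invertible in \<open>auto simp: local_L_def\<close>)
  show "local_L A F c x \<noteq> 0" if x: "x \<in> slit c"
  proof -
    obtain z \<eta> where x_eq: "x = (z, \<eta>)" and z: "z \<in> chart_image c" and "\<eta> \<noteq> 0"
      using x by (auto simp: slit_def)
    then have "snd (tvec_of A c (z, \<eta>)) \<noteq> (\<lambda>c. 0)"
      using tvec_of_self[OF c z, of \<eta>] by metis
    then show ?thesis
      using zero[OF tvec_of_in_bundle[OF c z]] by (simp add: local_L_def x_eq)
  qed
qed

theorem theorem4p3:
  fixes X :: "'a topology"
    and A :: "('a, 2) chart set"
    and F :: "('a, 2) tvec \<Rightarrow> real"
  assumes "complex_finsler X A F"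
    and "kaehler_finsler A F"
  shows "(\<forall>c\<in>A. \<forall>x\<in>slit c. \<forall>i h. d_etabar h (spray (local_L A F c) i) x = 0) \<and>
         (\<forall>c\<in>A. \<forall>z\<in>chart_image c.
            holomorphic_map_on (- {0}) (\<lambda>\<eta>. \<chi> i. spray (local_L A F c) i (z, \<eta>)))"
proof -
  have K: "kaehler_chart (slit c) (local_L A F c)" if c: "c \<in> A" for c
    using assms(2) c
    by (intro kaehler_chart.intro finsler_chart_local_L(1)[OF assms(1) c] kaehler_chart_axioms.intro)
      (simp add: kaehler_finsler_def)
  have 0: "d_etabar h (spray (local_L A F c) i) x = 0" if "c \<in> A" "x \<in> slit c" for c x i h
    using etabar_spray_dim2[OF K[OF that(1)] finsler_chart_local_L(2)[OF assms(1) that(1)] that(2)] .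
  \<comment> \<open>Each punctured fibre lies in the slit domain, so differentiability of the spray
    and the vanishing just proved give holomorphy there.\<close>
  have "holomorphic_map_on (- {0}) (\<lambda>\<eta>. \<chi> i. spray (local_L A F c) i (z, \<eta>))"
    if c: "c \<in> A" and z: "z \<in> chart_image c" for c z
  proof (rule holomorphic_in_eta)
    fix i h \<eta> assume "\<eta> \<in> - {0::complex^2}"
    then have x: "(z, \<eta>) \<in> slit c" using z by (simp add: slit_def)
    interpret kaehler_chart "slit c" "local_L A F c" by (rule K[OF c])
    show "spray (local_L A F c) i differentiable (at (z, \<eta>))"
      unfolding spray_G by (intro differentiable_divide differentiable_const differentiable_G x) simp
    show "d_etabar h (spray (local_L A F c) i) (z, \<eta>) = 0" by (rule 0[OF c x])
  qed
  with 0 show ?thesis by blast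
qed

end
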